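(* Let $E$ be a real Hausdorff locally convex space and $\mathcal{K}\subset E$ a pointed cone. The following are equivalent. (i) $\mathcal{K}$ satisfies the weak property $(\pi)$. (ii) $0\in \mathrm{bPC}(\mathcal{K})\cap \mathrm{DP}(\mathcal{K})$. (iii) $0\in \mathrm{bPC}(\mathcal{K})\cap\sigma(E,E^* )\text{-s-ext}(\mathcal{K})$. (iv) $0\in \mathrm{bPC}(\mathcal{K})$ and $\mathcal{K}^{**}$ is pointed. (v) $0\in \mathrm{bPC}(\mathcal{K})$ and $\mathrm{span}(\mathcal{K}^* )$ is $\beta(E^*,E)$-dense in $E^*$. (vi) There exist $n\ge 1$, $x_i^*\in\mathcal{K}^*$ for $i\in\{1,\dots,n\}$, and $\lambda>0$ such that $\bigcap_{i=1}^n\{x\in E: x_i^*(x)<\lambda\}\cap\mathcal{K}$ is bounded.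
   Context: $(E,\tau)$ is a real Hausdorff locally convex space with dual $E^*$; $\tau(x)$ and $\sigma(E,E^* )(x)$ denote the families of neighbourhoods of $x$ for $\tau$ and for the weak topology. $\beta(E^*,E)$ is the topology on $E^*$ of uniform convergence on bounded subsets of $E$, and $E^{**}$ is the dual of $(E^*,\beta(E^*,E))$. A cone $\mathcal{K}$ is a (nonempty) convex set with $\lambda k\in\mathcal{K}$ for all $\lambda\ge0$, $k\in\mathcal{K}$; it is pointed if $\mathcal{K}\cap(-\mathcal{K})=\{0\}$. $\mathcal{K}^*=\{x^*\in E^*: x^*(k)\ge0\ \forall k\in\mathcal{K}\}$ and $\mathcal{K}^{**}=\{x^{**}\in E^{**}: x^{**}(x^* )\ge0\ \forall x^*\in\mathcal{K}^*\}$. $\mathcal{K}$ satisfies the weak property $(\pi)$ if there exist $x^*\in\mathcal{K}^*$ and $\alpha>0$ such that $\mathcal{K}\cap\{x\in E:x^*(x)\le\alpha\}$ is bounded. For convex $C\subset E$ and $x\in C$: - $x\in\mathrm{DP}(C)$ if for every $U\in\tau(x)$, $x\notin\overline{\mathrm{conv}}(C\setminus U)$. - $x\in\mathrm{PC}(C)$ if for every $U\in\tau(x)$ there is $W\in\sigma(E,E^* )(x)$ with $W\cap C\subset U$; $x\in\mathrm{bPC}(C)$ if $x\in\mathrm{PC}(C)$ and there is $W\in\sigma(E,E^* )(x)$ with $W\cap C$ bounded. - $x\in\sigma(E,E^* )\text{-s-ext}(C)$ if for all nets $(c_\gamma)_{\gamma\in\Gamma},(c'_\gamma)_{\gamma\in\Gamma}$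 in $C$ with $\lim_\gamma\frac{c_\gamma+c'_\gamma}{2}=x$ in $\tau$, one has $\lim_\gamma c_\gamma=x$ in $\sigma(E,E^* )$. *)

theory Defs
  imports "HOL-Analysis.Analysis"
begin

section \<open>Hausdorff locally convex spaces\<close>

class hausdorff_lcs = real_vector + topological_ab_group_add + t2_space +
  assumes tendsto_scaleR_nhds:
      "filterlim (\<lambda>p. fst p *\<^sub>R snd p) (nhds (a *\<^sub>R x)) (nhds a \<times>\<^sub>F nhds x)"
    and locally_convex:
      "open U \<Longrightarrow> 0 \<in> U \<Longrightarrow> \<exists>V. open V \<and> 0 \<in> V \<and> V \<subseteq> U \<and>
         (\<forall>x\<in>V. \<forall>y\<in>V. \<forall>u\<ge>0. \<forall>v\<ge>0. u + v = 1 \<longrightarrow> u *\<^sub>R x + v *\<^sub>R y \<in> V)"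

text \<open>The constant \<^const>\<open>convex\<close> cannot occur in the class specification itself.\<close>

lemma locally_convex_lcs:
  fixes U :: "'a::hausdorff_lcs set"
  assumes "open U" "0 \<in> U"
  shows "\<exists>V. open V \<and> 0 \<in> V \<and> convex V \<and> V \<subseteq> U"
  using locally_convex[OF assms] unfolding convex_def by blast

instance real_normed_vector \<subseteq> hausdorff_lcs
proof
  fix a :: real and x :: 'a
  show "filterlim (\<lambda>p. fst p *\<^sub>R snd p) (nhds (a *\<^sub>R x)) (nhds a \<times>\<^sub>F nhds x)"
    by (intro tendsto_scaleR filterlim_fst filterlim_snd)
next
  fix U :: "'a set"
  assume "open U" "0 \<in> U"
  then obtain e where "e > 0" "ball 0 e \<subseteq> U"
    using open_contains_ball by blast
  moreover have "\<forall>x\<in>ball 0 e. \<forall>y\<in>ball 0 e. \<forall>u\<ge>0. \<forall>v\<ge>0.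
      u + v = 1 \<longrightarrow> u *\<^sub>R x + v *\<^sub>R y \<in> ball (0 :: 'a) e"
    using convex_ball[of "0 :: 'a" e] unfolding convex_def .
  ultimately show "\<exists>V. open V \<and> 0 \<in> V \<and> V \<subseteq> U \<and>
      (\<forall>x\<in>V. \<forall>y\<in>V. \<forall>u\<ge>0. \<forall>v\<ge>0. u + v = 1 \<longrightarrow> u *\<^sub>R x + v *\<^sub>R y \<in> V)"
    by (intro exI[of _ "ball 0 e"]) auto
qed

lemma tendsto_scaleR_lcs:
  fixes g :: "'b \<Rightarrow> 'a::hausdorff_lcs"
  assumes "(f \<longlongrightarrow> a) F" "(g \<longlongrightarrow> x) F"
  shows "((\<lambda>i. f i *\<^sub>R g i) \<longlongrightarrow> a *\<^sub>R x) F"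
  using filterlim_compose[OF tendsto_scaleR_nhds filterlim_Pair[OF assms]] by simp

text \<open>The library constant \<^const>\<open>bounded\<close> is metric; in a locally convex space boundedness means
  being absorbed by every neighbourhood of the origin.\<close>

definition vn_bounded :: "'a::{real_vector,topological_space} set \<Rightarrow> bool" where
  "vn_bounded B \<longleftrightarrow> (\<forall>U. open U \<and> 0 \<in> U \<longrightarrow> (\<exists>s>0. \<forall>t\<ge>s. B \<subseteq> (\<lambda>x. t *\<^sub>R x) ` U))"

lemma vn_bounded_Un:
  assumes "vn_bounded A" "vn_bounded B"
  shows "vn_bounded (A \<union> B)"
  unfolding vn_bounded_def
proof (intro allI impI)
  fix U :: "'a set"
  assume U: "open U \<and> 0 \<in> U"
  obtain s where s: "s > 0" "\<forall>t\<ge>s. A \<subseteq> (\<lambda>x. t *\<^sub>R x) ` U"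
    using assms(1) U unfolding vn_bounded_def by blast
  obtain s' where s': "s' > 0" "\<forall>t\<ge>s'. B \<subseteq> (\<lambda>x. t *\<^sub>R x) ` U"
    using assms(2) U unfolding vn_bounded_def by blast
  show "\<exists>s>0. \<forall>t\<ge>s. A \<union> B \<subseteq> (\<lambda>x. t *\<^sub>R x) ` U"
    using s s' by (intro exI[of _ "max s s'"]) auto
qed

lemma vn_bounded_singleton: "vn_bounded {x :: 'a::hausdorff_lcs}"
  unfolding vn_bounded_def
proof (intro allI impI)
  fix U :: "'a set"
  assume U: "open U \<and> 0 \<in> U"
  have "((\<lambda>t::real. inverse t *\<^sub>R x) \<longlongrightarrow> 0 *\<^sub>R x) at_top"
    by (intro tendsto_scaleR_lcs tendsto_inverse_0_at_top filterlim_ident tendsto_const)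
  then have "eventually (\<lambda>t::real. inverse t *\<^sub>R x \<in> U) at_top"
    using U by (auto dest: topological_tendstoD)
  then obtain N :: real where N: "\<And>t. t \<ge> N \<Longrightarrow> inverse t *\<^sub>R x \<in> U"
    by (auto simp: eventually_at_top_linorder)
  show "\<exists>s>0. \<forall>t\<ge>s. {x} \<subseteq> (\<lambda>x. t *\<^sub>R x) ` U"
  proof (intro exI[of _ "max N 1"] conjI allI impI)
    fix t :: real
    assume "max N 1 \<le> t"
    then have "x = t *\<^sub>R (inverse t *\<^sub>R x)" "inverse t *\<^sub>R x \<in> U"
      using N by auto
    then show "{x} \<subseteq> (\<lambda>x. t *\<^sub>R x) ` U" by blast
  qed auto
qed

section \<open>The dual space and its strong topology\<close>

typedef (overloaded) ('a::hausdorff_lcs) dual = "{f :: 'a \<Rightarrow> real. linear f \<and> continuous_on UNIV f}"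
  morphisms dual_apply Dual
  by (intro exI[of _ "\<lambda>_. 0"]) (auto simp: linear_iff)

setup_lifting type_definition_dual

instantiation dual :: (hausdorff_lcs) real_vector
begin

lift_definition zero_dual :: "'a dual" is "\<lambda>_. 0"
  by (auto simp: linear_iff)

lift_definition plus_dual :: "'a dual \<Rightarrow> 'a dual \<Rightarrow> 'a dual" is "\<lambda>f g x. f x + g x"
  by (auto simp: linear_iff algebra_simps intro!: continuous_intros)

lift_definition minus_dual :: "'a dual \<Rightarrow> 'a dual \<Rightarrow> 'a dual" is "\<lambda>f g x. f x - g x"
  by (auto simp: linear_iff algebra_simps intro!: continuous_intros)

lift_definition uminus_dual :: "'a dual \<Rightarrow> 'a dual" is "\<lambda>f x. - f x"
  by (auto simp: linear_iff algebra_simps intro!: continuous_intros)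

lift_definition scaleR_dual :: "real \<Rightarrow> 'a dual \<Rightarrow> 'a dual" is "\<lambda>a f x. a * f x"
  by (auto simp: linear_iff algebra_simps intro!: continuous_intros)

instance
  by standard (transfer; auto simp: algebra_simps)+

end

lemmas dual_apply_simps [simp] =
  zero_dual.rep_eq plus_dual.rep_eq minus_dual.rep_eq uminus_dual.rep_eq scaleR_dual.rep_eq

lemma dual_eqI: "(\<And>x. dual_apply f x = dual_apply g x) \<Longrightarrow> f = g"
  by (metis dual_apply_inject ext)

lemma linear_dual_apply: "linear (dual_apply f)"
  using dual_apply[of f] by simp

lemma continuous_on_dual_apply: "continuous_on UNIV (dual_apply f)"
  using dual_apply[of f] by simp

lemma vn_bounded_dual_apply:
  assumes "vn_bounded B"
  shows "\<exists>M>0. \<forall>x\<in>B. \<bar>dual_apply f x\<bar> < M"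
proof -
  let ?U = "{x. \<bar>dual_apply f x\<bar> < 1}"
  have "open ?U"
    by (intro open_Collect_less continuous_intros continuous_on_dual_apply)
  moreover have "0 \<in> ?U"
    using linear_0[OF linear_dual_apply[of f]] by simp
  ultimately obtain s where s: "s > 0" "\<forall>t\<ge>s. B \<subseteq> (\<lambda>x. t *\<^sub>R x) ` ?U"
    using assms[unfolded vn_bounded_def, rule_format, of ?U] by auto
  have "\<bar>dual_apply f x\<bar> < s" if "x \<in> B" for x
  proof -
    have "x \<in> (\<lambda>x. s *\<^sub>R x) ` ?U"
      using s(2) that by (meson order_refl subsetD)
    then obtain y where "x = s *\<^sub>R y" "\<bar>dual_apply f y\<bar> < 1"
      by blast
    then show ?thesis
      using s(1) by (simp add: linear_scale[OF linear_dual_apply] abs_mult)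
  qed
  with s(1) show ?thesis
    by blast
qed

text \<open>The canonical topology of the dual is the strong one, i.e. uniform convergence on bounded sets.
  It makes \<open>'a dual\<close> itself a Hausdorff locally convex space, so that \<open>'a dual dual\<close> is the bidual.\<close>

instantiation dual :: (hausdorff_lcs) topological_space
begin

definition open_dual :: "'a dual set \<Rightarrow> bool" where
  "open_dual S \<longleftrightarrow> (\<forall>f\<in>S. \<exists>B \<epsilon>. vn_bounded B \<and> \<epsilon> > 0 \<and>
     {g. \<forall>x\<in>B. \<bar>dual_apply g x - dual_apply f x\<bar> < \<epsilon>} \<subseteq> S)"

instance
proof
  show "open (UNIV :: 'a dual set)"
    unfolding open_dual_def
    by (intro ballI exI[of _ "{0}"] exI[of _ 1]) (simp add: vn_bounded_singleton)
next
  fix S T :: "'a dual set"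
  assume ST: "open S" "open T"
  show "open (S \<inter> T)"
    unfolding open_dual_def
  proof
    fix f assume f: "f \<in> S \<inter> T"
    obtain A d where A: "vn_bounded A" "d > 0"
      "{g. \<forall>x\<in>A. \<bar>dual_apply g x - dual_apply f x\<bar> < d} \<subseteq> S"
      using ST(1) f unfolding open_dual_def by blast
    obtain B e where B: "vn_bounded B" "e > 0"
      "{g. \<forall>x\<in>B. \<bar>dual_apply g x - dual_apply f x\<bar> < e} \<subseteq> T"
      using ST(2) f unfolding open_dual_def by blast
    show "\<exists>B \<epsilon>. vn_bounded B \<and> \<epsilon> > 0 \<and>
       {g. \<forall>x\<in>B. \<bar>dual_apply g x - dual_apply f x\<bar> < \<epsilon>} \<subseteq> S \<inter> T"
      using A B by (intro exI[of _ "A \<union> B"] exI[of _ "min d e"]) (simp add: vn_bounded_Un subset_iff)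
  qed
next
  fix K :: "'a dual set set"
  assume K: "\<forall>S\<in>K. open S"
  show "open (\<Union>K)"
    unfolding open_dual_def
  proof
    fix f assume "f \<in> \<Union>K"
    then obtain S where S: "S \<in> K" "f \<in> S" by blast
    then obtain B e where B: "vn_bounded B" "e > 0"
      "{g. \<forall>x\<in>B. \<bar>dual_apply g x - dual_apply f x\<bar> < e} \<subseteq> S"
      using K unfolding open_dual_def by blast
    have "S \<subseteq> \<Union>K" using S(1) by (rule Union_upper)
    then show "\<exists>B \<epsilon>. vn_bounded B \<and> \<epsilon> > 0 \<and>
       {g. \<forall>x\<in>B. \<bar>dual_apply g x - dual_apply f x\<bar> < \<epsilon>} \<subseteq> \<Union>K"
      using B by (intro exI[of _ B] exI[of _ e] conjI) (assumption | erule (1) subset_trans)+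
  qed
qed

end

lemma open_dual_basic:
  assumes "vn_bounded B"
  shows "open {g. \<exists>\<delta><\<epsilon>. \<forall>x\<in>B. \<bar>dual_apply g x - dual_apply f x\<bar> \<le> \<delta>}" (is "open ?S")
  unfolding open_dual_def
proof
  fix g assume "g \<in> ?S"
  then obtain d where d: "d < \<epsilon>" "\<forall>x\<in>B. \<bar>dual_apply g x - dual_apply f x\<bar> \<le> d" by blast
  have "{h. \<forall>x\<in>B. \<bar>dual_apply h x - dual_apply g x\<bar> < (\<epsilon> - d) / 2} \<subseteq> ?S"
  proof
    fix h assume h: "h \<in> {h. \<forall>x\<in>B. \<bar>dual_apply h x - dual_apply g x\<bar> < (\<epsilon> - d) / 2}"
    have "\<bar>dual_apply h x - dual_apply f x\<bar> \<le> (\<epsilon> + d) / 2" if "x \<in> B" for x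
    proof -
      have "\<bar>dual_apply h x - dual_apply g x\<bar> < (\<epsilon> - d) / 2"
        "\<bar>dual_apply g x - dual_apply f x\<bar> \<le> d"
        using h d that by auto
      then show ?thesis by (simp add: field_simps) argo
    qed
    then show "h \<in> ?S" using d(1) by (intro CollectI exI[of _ "(\<epsilon> + d) / 2"]) auto
  qed
  then show "\<exists>A \<eta>. vn_bounded A \<and> \<eta> > 0 \<and>
      {h. \<forall>x\<in>A. \<bar>dual_apply h x - dual_apply g x\<bar> < \<eta>} \<subseteq> ?S"
    using assms d(1) by (intro exI[of _ B] exI[of _ "(\<epsilon> - d) / 2"]) auto
qed

lemma eventually_nhds_dual:
  "eventually P (nhds f) \<longleftrightarrow> (\<exists>B \<epsilon>. vn_bounded B \<and> \<epsilon> > 0 \<and>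
     (\<forall>g. (\<forall>x\<in>B. \<bar>dual_apply g x - dual_apply f x\<bar> < \<epsilon>) \<longrightarrow> P g))"
proof
  assume "eventually P (nhds f)"
  then obtain S where S: "open S" "f \<in> S" "\<forall>g\<in>S. P g"
    by (auto simp: eventually_nhds)
  then obtain B e where B: "vn_bounded B" "e > 0"
    "{g. \<forall>x\<in>B. \<bar>dual_apply g x - dual_apply f x\<bar> < e} \<subseteq> S"
    unfolding open_dual_def by blast
  then show "\<exists>B \<epsilon>. vn_bounded B \<and> \<epsilon> > 0 \<and>
     (\<forall>g. (\<forall>x\<in>B. \<bar>dual_apply g x - dual_apply f x\<bar> < \<epsilon>) \<longrightarrow> P g)"
    using S(3) by (intro exI[of _ B] exI[of _ e]) (simp add: subset_iff)
next
  assume "\<exists>B \<epsilon>. vn_bounded B \<and> \<epsilon> > 0 \<and>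
     (\<forall>g. (\<forall>x\<in>B. \<bar>dual_apply g x - dual_apply f x\<bar> < \<epsilon>) \<longrightarrow> P g)"
  then obtain B e where B: "vn_bounded B" "e > 0"
    "\<And>g. (\<forall>x\<in>B. \<bar>dual_apply g x - dual_apply f x\<bar> < e) \<Longrightarrow> P g"
    by blast
  show "eventually P (nhds f)"
    unfolding eventually_nhds
  proof (intro exI conjI)
    show "open {g. \<exists>\<delta><e. \<forall>x\<in>B. \<bar>dual_apply g x - dual_apply f x\<bar> \<le> \<delta>}"
      by (rule open_dual_basic[OF B(1)])
    show "f \<in> {g. \<exists>\<delta><e. \<forall>x\<in>B. \<bar>dual_apply g x - dual_apply f x\<bar> \<le> \<delta>}"
      using B(2) by (auto intro!: exI[of _ 0])
    show "\<forall>g\<in>{g. \<exists>\<delta><e. \<forall>x\<in>B. \<bar>dual_apply g x - dual_apply f x\<bar> \<le> \<delta>}. P g"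
      using B(3) by (auto intro: le_less_trans)
  qed
qed

lemma tendsto_dual_iff:
  fixes f :: "'a::hausdorff_lcs dual"
  shows "(F \<longlongrightarrow> f) G \<longleftrightarrow> (\<forall>B \<epsilon>. vn_bounded B \<and> \<epsilon> > 0 \<longrightarrow>
     eventually (\<lambda>i. \<forall>x\<in>B. \<bar>dual_apply (F i) x - dual_apply f x\<bar> < \<epsilon>) G)"
proof
  assume L: "(F \<longlongrightarrow> f) G"
  show "\<forall>B \<epsilon>. vn_bounded B \<and> \<epsilon> > 0 \<longrightarrow>
     eventually (\<lambda>i. \<forall>x\<in>B. \<bar>dual_apply (F i) x - dual_apply f x\<bar> < \<epsilon>) G"
  proof (intro allI impI)
    fix B :: "'a set" and \<epsilon> :: real
    assume "vn_bounded B \<and> \<epsilon> > 0"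
    then have "eventually (\<lambda>g. \<forall>x\<in>B. \<bar>dual_apply g x - dual_apply f x\<bar> < \<epsilon>) (nhds f)"
      by (auto simp: eventually_nhds_dual)
    then show "eventually (\<lambda>i. \<forall>x\<in>B. \<bar>dual_apply (F i) x - dual_apply f x\<bar> < \<epsilon>) G"
      using L by (rule eventually_compose_filterlim)
  qed
next
  assume R: "\<forall>B \<epsilon>. vn_bounded B \<and> \<epsilon> > 0 \<longrightarrow>
     eventually (\<lambda>i. \<forall>x\<in>B. \<bar>dual_apply (F i) x - dual_apply f x\<bar> < \<epsilon>) G"
  show "(F \<longlongrightarrow> f) G"
    unfolding filterlim_iff
  proof (intro allI impI)
    fix P assume "eventually P (nhds f)"
    then obtain B e where B: "vn_bounded B" "e > 0"
      "\<And>g. (\<forall>x\<in>B. \<bar>dual_apply g x - dual_apply f x\<bar> < e) \<Longrightarrow> P g"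
      unfolding eventually_nhds_dual by blast
    have "eventually (\<lambda>i. \<forall>x\<in>B. \<bar>dual_apply (F i) x - dual_apply f x\<bar> < e) G"
      using R B(1,2) by blast
    then show "eventually (\<lambda>i. P (F i)) G"
      by (rule eventually_mono) (rule B(3))
  qed
qed

instance dual :: (hausdorff_lcs) hausdorff_lcs
proof
  fix f g :: "'a dual"
  show "LIM p (nhds f \<times>\<^sub>F nhds g). fst p + snd p :> nhds (f + g)"
    unfolding tendsto_dual_iff
  proof (intro allI impI)
    fix B :: "'a set" and \<epsilon> :: real
    assume B: "vn_bounded B \<and> \<epsilon> > 0"
    have 1: "eventually (\<lambda>h. \<forall>x\<in>B. \<bar>dual_apply h x - dual_apply f x\<bar> < \<epsilon> / 2) (nhds f)"
      using B unfolding eventually_nhds_dual by (intro exI[of _ B] exI[of _ "\<epsilon> / 2"]) auto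
    have 2: "eventually (\<lambda>h. \<forall>x\<in>B. \<bar>dual_apply h x - dual_apply g x\<bar> < \<epsilon> / 2) (nhds g)"
      using B unfolding eventually_nhds_dual by (intro exI[of _ B] exI[of _ "\<epsilon> / 2"]) auto
    have 3: "\<bar>dual_apply (h + k) x - dual_apply (f + g) x\<bar> < \<epsilon>"
      if "\<bar>dual_apply h x - dual_apply f x\<bar> < \<epsilon> / 2" "\<bar>dual_apply k x - dual_apply g x\<bar> < \<epsilon> / 2"
      for h k x
      using that unfolding dual_apply_simps by argo
    show "\<forall>\<^sub>F p in nhds f \<times>\<^sub>F nhds g.
        \<forall>x\<in>B. \<bar>dual_apply (fst p + snd p) x - dual_apply (f + g) x\<bar> < \<epsilon>"
      using eventually_prodI[OF 1 2] by (rule eventually_mono) (use 3 in blast)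
  qed
next
  fix f :: "'a dual"
  show "(uminus \<longlongrightarrow> - f) (nhds f)"
    unfolding tendsto_dual_iff
  proof (intro allI impI)
    fix B :: "'a set" and \<epsilon> :: real
    assume B: "vn_bounded B \<and> \<epsilon> > 0"
    have "\<bar>dual_apply (- g) x - dual_apply (- f) x\<bar> = \<bar>dual_apply g x - dual_apply f x\<bar>" for g x
      by simp
    then show "\<forall>\<^sub>F g in nhds f. \<forall>x\<in>B. \<bar>dual_apply (- g) x - dual_apply (- f) x\<bar> < \<epsilon>"
      using B unfolding eventually_nhds_dual by (intro exI[of _ B] exI[of _ \<epsilon>]) simp
  qed
next
  fix f g :: "'a dual"
  assume "f \<noteq> g"
  then obtain x where x: "dual_apply f x \<noteq> dual_apply g x"
    using dual_eqI by blast
  define e where "e = \<bar>dual_apply f x - dual_apply g x\<bar> / 2"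
  have e: "e > 0" using x by (simp add: e_def)
  let ?D = "\<lambda>f. {h. \<exists>\<delta><e. \<forall>x\<in>{x}. \<bar>dual_apply h x - dual_apply f x\<bar> \<le> \<delta>}"
  have "open (?D f)" "open (?D g)"
    by (intro open_dual_basic vn_bounded_singleton)+
  moreover have "f \<in> ?D f" "g \<in> ?D g"
    using e by (auto intro!: exI[of _ 0])
  moreover have "?D f \<inter> ?D g = {}"
    by (auto simp: e_def)
  ultimately show "\<exists>U V. open U \<and> open V \<and> f \<in> U \<and> g \<in> V \<and> U \<inter> V = {}"
    by blast
next
  fix a :: real and f :: "'a dual"
  show "LIM p (nhds a \<times>\<^sub>F nhds f). fst p *\<^sub>R snd p :> nhds (a *\<^sub>R f)"
    unfolding tendsto_dual_iff
  proof (intro allI impI)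
    fix B :: "'a set" and \<epsilon> :: real
    assume B: "vn_bounded B \<and> \<epsilon> > 0"
    then obtain M where M: "M > 0" "\<And>x. x \<in> B \<Longrightarrow> \<bar>dual_apply f x\<bar> < M"
      using vn_bounded_dual_apply by blast
    define d where "d = min 1 (\<epsilon> / (2 * M))"
    define e where "e = \<epsilon> / (2 * (\<bar>a\<bar> + 1))"
    have d: "0 < d" "d \<le> 1" "d * M \<le> \<epsilon> / 2"
      using B M by (auto simp: d_def min_def field_simps)
    have e: "0 < e" "(\<bar>a\<bar> + 1) * e = \<epsilon> / 2"
      using B by (auto simp: e_def field_simps)
    have 1: "eventually (\<lambda>b. \<bar>b - a\<bar> < d) (nhds a)"
      using d(1) by (auto simp: eventually_nhds_metric dist_real_def)
    have 2: "eventually (\<lambda>h. \<forall>x\<in>B. \<bar>dual_apply h x - dual_apply f x\<bar> < e) (nhds f)"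
      using B e unfolding eventually_nhds_dual by blast
    have 3: "\<bar>dual_apply (b *\<^sub>R h) x - dual_apply (a *\<^sub>R f) x\<bar> < \<epsilon>"
      if "\<bar>b - a\<bar> < d" "\<bar>dual_apply h x - dual_apply f x\<bar> < e" "x \<in> B" for b h x
    proof -
      have "dual_apply (b *\<^sub>R h) x - dual_apply (a *\<^sub>R f) x
          = b * (dual_apply h x - dual_apply f x) + (b - a) * dual_apply f x"
        by (simp add: algebra_simps)
      also have "\<bar>\<dots>\<bar> \<le> \<bar>b\<bar> * \<bar>dual_apply h x - dual_apply f x\<bar> + \<bar>b - a\<bar> * \<bar>dual_apply f x\<bar>"
        by (metis abs_mult abs_triangle_ineq)
      also have "\<bar>b\<bar> * \<bar>dual_apply h x - dual_apply f x\<bar> \<le> (\<bar>a\<bar> + 1) * e"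
        using that d by (intro mult_mono) auto
      also have "\<bar>b - a\<bar> * \<bar>dual_apply f x\<bar> < d * M"
        using that M(2)[OF that(3)] d M(1) by (intro mult_strict_mono) auto
      finally show ?thesis using d e by linarith
    qed
    show "\<forall>\<^sub>F p in nhds a \<times>\<^sub>F nhds f.
        \<forall>x\<in>B. \<bar>dual_apply (fst p *\<^sub>R snd p) x - dual_apply (a *\<^sub>R f) x\<bar> < \<epsilon>"
      using eventually_prodI[OF 1 2] by (rule eventually_mono) (use 3 in blast)
  qed
next
  fix U :: "'a dual set"
  assume "open U" "0 \<in> U"
  then obtain B e where B: "vn_bounded B" "e > 0"
    "{g. \<forall>x\<in>B. \<bar>dual_apply g x - dual_apply 0 x\<bar> < e} \<subseteq> U"
    unfolding open_dual_def by blast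
  let ?V = "{g. \<exists>\<delta><e. \<forall>x\<in>B. \<bar>dual_apply g x - dual_apply 0 x\<bar> \<le> \<delta>}"
  have "convex ?V"
  proof (rule convexI)
    fix g h and u v :: real
    assume "g \<in> ?V" "h \<in> ?V" and uv: "0 \<le> u" "0 \<le> v" "u + v = 1"
    then obtain d d' where d: "d < e" "d' < e" "\<And>x. x \<in> B \<Longrightarrow> \<bar>dual_apply g x\<bar> \<le> d"
        "\<And>x. x \<in> B \<Longrightarrow> \<bar>dual_apply h x\<bar> \<le> d'"
      by auto
    have "\<bar>u * dual_apply g x + v * dual_apply h x\<bar> \<le> max d d'" if "x \<in> B" for x
    proof -
      have "\<bar>u * dual_apply g x + v * dual_apply h x\<bar>
          \<le> u * \<bar>dual_apply g x\<bar> + v * \<bar>dual_apply h x\<bar>"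
        using uv by (metis abs_mult abs_of_nonneg abs_triangle_ineq)
      also have "\<dots> \<le> u * max d d' + v * max d d'"
        using uv d(3,4)[OF that] by (intro add_mono mult_left_mono) auto
      also have "\<dots> = max d d'"
        using uv by (simp flip: distrib_right)
      finally show ?thesis .
    qed
    then show "u *\<^sub>R g + v *\<^sub>R h \<in> ?V"
      using d(1,2) by (intro CollectI exI[of _ "max d d'"]) auto
  qed
  moreover have "open ?V" by (rule open_dual_basic[OF B(1)])
  moreover have "0 \<in> ?V" using B(2) by (auto intro!: exI[of _ 0])
  moreover have "?V \<subseteq> U" using B(3) by (auto simp: subset_iff intro: le_less_trans)
  ultimately show "\<exists>V. open V \<and> 0 \<in> V \<and> V \<subseteq> U \<and>
      (\<forall>x\<in>V. \<forall>y\<in>V. \<forall>u\<ge>0. \<forall>v\<ge>0. u + v = 1 \<longrightarrow> u *\<^sub>R x + v *\<^sub>R y \<in> V)"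
    unfolding convex_def by blast
qed

section \<open>The weak topology and neighbourhoods\<close>

definition weak_topology :: "'a::hausdorff_lcs topology" where
  "weak_topology = topology_generated_by {dual_apply f -` V | f V. open V}"

lemma topspace_weak_topology [simp]: "topspace weak_topology = UNIV"
proof -
  have "dual_apply (0 :: 'a dual) -` UNIV \<in> {dual_apply f -` V | f V. open V}" by blast
  then show ?thesis unfolding weak_topology_def by auto
qed

definition neighbourhoods :: "'a topology \<Rightarrow> 'a \<Rightarrow> 'a set set" where
  "neighbourhoods X x = {U. \<exists>V. openin X V \<and> x \<in> V \<and> V \<subseteq> U \<and> U \<subseteq> topspace X}"

section \<open>Cones\<close>

definition pointed :: "'a::real_vector set \<Rightarrow> bool" where
  "pointed K \<longleftrightarrow> K \<inter> uminus ` K = {0}"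

definition dual_cone :: "'a::hausdorff_lcs set \<Rightarrow> 'a dual set" where
  "dual_cone K = {f. \<forall>k\<in>K. dual_apply f k \<ge> 0}"

definition weak_property_pi :: "'a::hausdorff_lcs set \<Rightarrow> bool" where
  "weak_property_pi K \<longleftrightarrow>
     (\<exists>f\<in>dual_cone K. \<exists>\<alpha>>0. vn_bounded (K \<inter> {x. dual_apply f x \<le> \<alpha>}))"

section \<open>Denting points, points of continuity and strongly extreme points\<close>

definition denting_points :: "'a::hausdorff_lcs set \<Rightarrow> 'a set" where
  "denting_points C =
     {x\<in>C. \<forall>U\<in>neighbourhoods euclidean x. x \<notin> closure (convex hull (C - U))}"

definition pts_of_continuity :: "'a::hausdorff_lcs set \<Rightarrow> 'a set" where
  "pts_of_continuity C =
     {x\<in>C. \<forall>U\<in>neighbourhoods euclidean x. \<exists>W\<in>neighbourhoods weak_topology x. W \<inter> C \<subseteq> U}"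

definition bounded_pts_of_continuity :: "'a::hausdorff_lcs set \<Rightarrow> 'a set" where
  "bounded_pts_of_continuity C =
     {x\<in>pts_of_continuity C. \<exists>W\<in>neighbourhoods weak_topology x. vn_bounded (W \<inter> C)}"

definition directed_set :: "'i set \<Rightarrow> 'i rel \<Rightarrow> bool" where
  "directed_set \<Gamma> r \<longleftrightarrow> \<Gamma> \<noteq> {} \<and> preorder_on \<Gamma> r \<and>
     (\<forall>a\<in>\<Gamma>. \<forall>b\<in>\<Gamma>. \<exists>c\<in>\<Gamma>. (a, c) \<in> r \<and> (b, c) \<in> r)"

text \<open>The filter of tails of a directed set: a net \<open>c\<close> converges iff it converges along it.\<close>

definition tails :: "'i set \<Rightarrow> 'i rel \<Rightarrow> 'i filter" where
  "tails \<Gamma> r = (INF \<gamma>\<in>\<Gamma>. principal {\<delta>\<in>\<Gamma>. (\<gamma>, \<delta>) \<in> r})"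

lemma eventually_tails:
  assumes "directed_set \<Gamma> r"
  shows "eventually P (tails \<Gamma> r) \<longleftrightarrow> (\<exists>\<gamma>\<in>\<Gamma>. \<forall>\<delta>\<in>\<Gamma>. (\<gamma>, \<delta>) \<in> r \<longrightarrow> P \<delta>)"
proof -
  have tr: "trans r"
    using assms by (auto simp: directed_set_def preorder_on_def)
  have "eventually P (tails \<Gamma> r)
      \<longleftrightarrow> (\<exists>\<gamma>\<in>\<Gamma>. eventually P (principal {\<delta>\<in>\<Gamma>. (\<gamma>, \<delta>) \<in> r}))"
    unfolding tails_def
  proof (rule eventually_INF_base)
    show "\<Gamma> \<noteq> {}" using assms by (simp add: directed_set_def)
  next
    fix a b assume "a \<in> \<Gamma>" "b \<in> \<Gamma>"
    then obtain c where c: "c \<in> \<Gamma>" "(a, c) \<in> r" "(b, c) \<in> r"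
      using assms unfolding directed_set_def by blast
    show "\<exists>x\<in>\<Gamma>. principal {\<delta>\<in>\<Gamma>. (x, \<delta>) \<in> r}
        \<le> inf (principal {\<delta>\<in>\<Gamma>. (a, \<delta>) \<in> r}) (principal {\<delta>\<in>\<Gamma>. (b, \<delta>) \<in> r})"
      using c tr by (intro bexI[of _ c]) (auto dest: transD)
  qed
  then show ?thesis by (auto simp: eventually_principal)
qed

text \<open>A definition cannot quantify over the type of the index set of a net. Directed sets of type
  \<open>'a set\<close> suffice: the lemma \<open>weak_s_extD\<close> below extends the defining property to nets with
  arbitrary index type.\<close>

definition weak_s_ext :: "'a::hausdorff_lcs set \<Rightarrow> 'a set" where
  "weak_s_ext C = {x\<in>C. \<forall>(\<Gamma> :: 'a set set) r c c'.
     directed_set \<Gamma> r \<and> (\<forall>\<gamma>\<in>\<Gamma>. c \<gamma> \<in> C \<and> c' \<gamma> \<in> C) \<and>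
     limitin euclidean (\<lambda>\<gamma>. midpoint (c \<gamma>) (c' \<gamma>)) x (tails \<Gamma> r) \<longrightarrow>
     limitin weak_topology c x (tails \<Gamma> r)}"

lemma weak_s_extD:
  fixes C :: "'a::hausdorff_lcs set" and \<Gamma> :: "'i set"
  assumes x: "x \<in> weak_s_ext C" and \<Gamma>: "directed_set \<Gamma> r"
    and C: "\<And>\<gamma>. \<gamma> \<in> \<Gamma> \<Longrightarrow> c \<gamma> \<in> C \<and> c' \<gamma> \<in> C"
    and lim: "limitin euclidean (\<lambda>\<gamma>. midpoint (c \<gamma>) (c' \<gamma>)) x (tails \<Gamma> r)"
  shows "limitin weak_topology c x (tails \<Gamma> r)"
proof (rule ccontr)
  assume "\<not> ?thesis"
  then obtain W where W: "openin weak_topology W" "x \<in> W"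
    "\<not> eventually (\<lambda>\<gamma>. c \<gamma> \<in> W) (tails \<Gamma> r)"
    by (auto simp: limitin_def)
  have "\<exists>\<gamma>\<in>\<Gamma>. midpoint (c \<gamma>) (c' \<gamma>) \<in> U \<and> c \<gamma> \<notin> W" if "open U" "x \<in> U" for U
  proof -
    have "eventually (\<lambda>\<gamma>. midpoint (c \<gamma>) (c' \<gamma>) \<in> U) (tails \<Gamma> r)"
      using lim that by (auto simp: limitin_def)
    then obtain \<gamma> where "\<gamma> \<in> \<Gamma>" "\<And>\<delta>. \<delta> \<in> \<Gamma> \<Longrightarrow> (\<gamma>, \<delta>) \<in> r \<Longrightarrow> midpoint (c \<delta>) (c' \<delta>) \<in> U"
      unfolding eventually_tails[OF \<Gamma>] by blast
    moreover from this(1) obtain \<delta> where "\<delta> \<in> \<Gamma>" "(\<gamma>, \<delta>) \<in> r" "c \<delta> \<notin> W"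
      using W(3) unfolding eventually_tails[OF \<Gamma>] by blast
    ultimately show ?thesis by blast
  qed
  then obtain s where s: "\<And>U. open U \<Longrightarrow> x \<in> U \<Longrightarrow>
      s U \<in> \<Gamma> \<and> midpoint (c (s U)) (c' (s U)) \<in> U \<and> c (s U) \<notin> W"
    by metis
  define \<Delta> where "\<Delta> = {U. open U \<and> x \<in> U}"
  define q where "q = {(U, V). U \<in> \<Delta> \<and> V \<in> \<Delta> \<and> V \<subseteq> U}"
  have \<Delta>: "directed_set \<Delta> q"
    unfolding directed_set_def
  proof (intro conjI ballI)
    show "\<Delta> \<noteq> {}" by (auto simp: \<Delta>_def)
    show "preorder_on \<Delta> q"
      by (auto simp: preorder_on_def refl_on_def trans_def q_def)
    fix U V assume "U \<in> \<Delta>" "V \<in> \<Delta>"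
    then show "\<exists>T\<in>\<Delta>. (U, T) \<in> q \<and> (V, T) \<in> q"
      by (intro bexI[of _ "U \<inter> V"]) (auto simp: \<Delta>_def q_def)
  qed
  have "limitin euclidean (\<lambda>U. midpoint (c (s U)) (c' (s U))) x (tails \<Delta> q)"
    unfolding limitin_def
  proof (intro conjI allI impI)
    fix U assume U: "openin euclidean U \<and> x \<in> U"
    have "\<forall>V\<in>\<Delta>. (U, V) \<in> q \<longrightarrow> midpoint (c (s V)) (c' (s V)) \<in> U"
      using s by (auto simp: \<Delta>_def q_def)
    then show "eventually (\<lambda>V. midpoint (c (s V)) (c' (s V)) \<in> U) (tails \<Delta> q)"
      unfolding eventually_tails[OF \<Delta>] using U by (intro bexI[of _ U]) (auto simp: \<Delta>_def)
  qed simp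
  moreover have "\<forall>U\<in>\<Delta>. c (s U) \<in> C \<and> c' (s U) \<in> C"
    using s C by (auto simp: \<Delta>_def)
  ultimately have "limitin weak_topology (\<lambda>U. c (s U)) x (tails \<Delta> q)"
    using x \<Delta> unfolding weak_s_ext_def mem_Collect_eq
    by (elim conjE) (drule spec[of _ \<Delta>], drule spec[of _ q], drule spec[of _ "\<lambda>U. c (s U)"],
        drule spec[of _ "\<lambda>U. c' (s U)"], simp)
  then have "eventually (\<lambda>U. c (s U) \<in> W) (tails \<Delta> q)"
    using W by (auto simp: limitin_def)
  then obtain U where U: "U \<in> \<Delta>" "\<And>V. V \<in> \<Delta> \<Longrightarrow> (U, V) \<in> q \<Longrightarrow> c (s V) \<in> W"
    unfolding eventually_tails[OF \<Delta>] by blast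
  have "c (s U) \<in> W"
    using U by (auto simp: q_def)
  then show False
    using s U(1) by (auto simp: \<Delta>_def)
qed

end

theory Submission
  imports Defs
begin

text \<open>A functional separating \<open>0\<close>
  from the part of \<open>K\<close> outside a bounded weak neighbourhood witnesses the weak property directly. If
  \<open>0\<close> is a weakly strongly extreme point, then \<open>K\<close> is normal for the weak topology, and separating
  \<open>0\<close> from \<open>{k \<in> K. f k \<ge> 1} + K\<close> writes any \<open>f\<close> as a difference of two elements of the dual cone.
  Finally, if the span of the dual cone is dense, the finitely many functionals that cut out a bounded
  weak neighbourhood in \<open>K\<close> are approximated on that bounded set by differences \<open>g - h\<close>, and a scaling
  argument shows that the functionals \<open>g\<close> and \<open>h\<close> already cut out a bounded piece of \<open>K\<close>.\<close>

section \<open>The Hahn--Banach theorem\<close>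

text \<open>Homogeneity is stated as an inequality for \<open>t > 0\<close>. Applied to
  \<open>inverse t\<close> it turns into an equality, so one-sided estimates suffice to show that a
  functional is sublinear.\<close>

definition sublinear :: "('a::real_vector \<Rightarrow> real) \<Rightarrow> bool" where
  "sublinear p \<longleftrightarrow> (\<forall>x y. p (x + y) \<le> p x + p y) \<and> (\<forall>t>0. \<forall>x. p (t *\<^sub>R x) \<le> t * p x)"

lemma sublinearD:
  assumes "sublinear p"
  shows sublinear_add: "p (x + y) \<le> p x + p y"
    and sublinear_zero: "p 0 = 0"
    and sublinear_scale: "t \<ge> 0 \<Longrightarrow> p (t *\<^sub>R x) = t * p x"
    and sublinear_ge: "- p (- x) \<le> p x"
proof -
  have le: "p (t *\<^sub>R x) \<le> t * p x" if "t > 0" for t x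
    using assms that unfolding sublinear_def by blast
  show add: "p (x + y) \<le> p x + p y" for x y
    using assms unfolding sublinear_def by blast
  \<comment> \<open>\<open>t = 1/2\<close> gives \<open>p 0 \<le> 0\<close>, and
    \<open>t = 2\<close> gives \<open>p 0 \<ge> 0\<close>.\<close>
  show zero: "p 0 = 0"
    using le[of "1/2" 0] le[of 2 0] by simp
  show "p (t *\<^sub>R x) = t * p x" if "t \<ge> 0"
  proof (cases "t = 0")
    case False
    with that have "t > 0" by simp
    then have "t * p x \<le> p (t *\<^sub>R x)"
      using le[of "inverse t" "t *\<^sub>R x"] by (simp add: field_simps)
    with le[OF \<open>t > 0\<close>] show ?thesis by (intro antisym)
  qed (simp add: zero)
  show "- p (- x) \<le> p x"
    using add[of x "- x"] zero by simp
qed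

text \<open>Supplies the lower bounds of chains for Zorn's lemma. The infimum is finite because
  \<open>q x \<ge> - q (- x) \<ge> - p (- x)\<close>, and it is subadditive because two members of a
  chain can both be replaced by the smaller one.\<close>

lemma sublinear_cINF:
  assumes "Q \<noteq> {}" and Q: "\<And>q. q \<in> Q \<Longrightarrow> sublinear q \<and> q \<le> p"
    and chain: "\<And>q r. q \<in> Q \<Longrightarrow> r \<in> Q \<Longrightarrow> q \<le> r \<or> r \<le> q"
  shows "sublinear (\<lambda>x. INF q\<in>Q. q x)" and "q \<in> Q \<Longrightarrow> (INF q\<in>Q. q x) \<le> q x"
proof -
  have bdd: "bdd_below ((\<lambda>q. q x) ` Q)" for x
  proof (rule bdd_belowI2)
    fix q assume "q \<in> Q"
    then have "sublinear q" "q (- x) \<le> p (- x)"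
      using Q by (auto simp: le_fun_def)
    then show "- p (- x) \<le> q x"
      using sublinear_ge[of q x] by linarith
  qed
  show low: "(INF q\<in>Q. q x) \<le> q x" if "q \<in> Q" for q x
    by (rule cINF_lower[OF bdd that])
  show "sublinear (\<lambda>x. INF q\<in>Q. q x)"
    unfolding sublinear_def
  proof (intro conjI allI impI)
    fix x y
    have *: "(INF q\<in>Q. q (x + y)) \<le> q x + r y" if qr: "q \<in> Q" "r \<in> Q" for q r
    proof -
      obtain m where m: "m \<in> Q" "m \<le> q" "m \<le> r"
        using chain[OF qr] qr by blast
      then have "(INF q\<in>Q. q (x + y)) \<le> m x + m y"
        using low[OF m(1), of "x + y"] sublinear_add[of m x y] Q[OF m(1)] by linarith
      with m(2,3) show ?thesis
        by (meson add_mono le_funD order_trans)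
    qed
    have "(INF q\<in>Q. q (x + y)) - r y \<le> (INF q\<in>Q. q x)" if "r \<in> Q" for r
      using *[OF _ that] assms(1) by (intro cINF_greatest) (auto simp: algebra_simps)
    then have "(INF q\<in>Q. q (x + y)) - (INF q\<in>Q. q x) \<le> (INF r\<in>Q. r y)"
      using assms(1) by (intro cINF_greatest) (auto simp: algebra_simps)
    then show "(INF q\<in>Q. q (x + y)) \<le> (INF q\<in>Q. q x) + (INF q\<in>Q. q y)"
      by linarith
  next
    fix t :: real and x assume t: "t > 0"
    have "(INF q\<in>Q. q (t *\<^sub>R x)) / t \<le> (INF q\<in>Q. q x)"
    proof (rule cINF_greatest[OF assms(1)])
      fix q assume q: "q \<in> Q"
      have "(INF q\<in>Q. q (t *\<^sub>R x)) \<le> t * q x"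
        using low[OF q, of "t *\<^sub>R x"] sublinear_scale[of q t x] Q[OF q] t by simp
      then show "(INF q\<in>Q. q (t *\<^sub>R x)) / t \<le> q x"
        using t by (simp add: field_simps)
    qed
    then show "(INF q\<in>Q. q (t *\<^sub>R x)) \<le> t * (INF q\<in>Q. q x)"
      using t by (simp add: field_simps)
  qed
qed

text \<open>For fixed \<open>x\<close>, the infimum \<open>r y\<close> of
  \<open>m (y + t *\<^sub>R x) - t * m x\<close> over \<open>t \<ge> 0\<close> is again sublinear
  and lies below \<open>m\<close>, so it equals \<open>m\<close>. Taking \<open>t = 1\<close> then
  shows that \<open>m\<close> is superadditive.\<close>

lemma minimal_sublinear_linear:
  assumes m: "sublinear m" and minimal: "\<And>q. sublinear q \<Longrightarrow> q \<le> m \<Longrightarrow> q = m"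
  shows "linear m"
proof -
  have super: "m y + m x \<le> m (y + x)" for x y
  proof -
    define r where "r = (\<lambda>y. INF t\<in>{0..}. m (y + t *\<^sub>R x) - t * m x)"
    have bdd: "bdd_below ((\<lambda>t. m (y + t *\<^sub>R x) - t * m x) ` {0..})" for y
    proof (rule bdd_belowI2)
      fix t :: real assume "t \<in> {0..}"
      then have "m (t *\<^sub>R x) = t * m x"
        using sublinear_scale[OF m] by simp
      then show "- m (- y) \<le> m (y + t *\<^sub>R x) - t * m x"
        using sublinear_add[OF m, of "- y" "y + t *\<^sub>R x"] by simp
    qed
    have low: "r y \<le> m (y + t *\<^sub>R x) - t * m x" if "t \<ge> 0" for y t
      unfolding r_def by (rule cINF_lower[OF bdd]) (use that in simp)
    have great: "c \<le> r y" if "\<And>t. t \<ge> 0 \<Longrightarrow> c \<le> m (y + t *\<^sub>R x) - t * m x" for c y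
      unfolding r_def by (rule cINF_greatest) (use that in auto)
    have "sublinear r"
      unfolding sublinear_def
    proof (intro conjI allI impI)
      fix y z
      have *: "r (y + z) \<le> (m (y + t *\<^sub>R x) - t * m x) + (m (z + s *\<^sub>R x) - s * m x)"
        if "t \<ge> 0" "s \<ge> 0" for t s
        using low[of "t + s" "y + z"] sublinear_add[OF m, of "y + t *\<^sub>R x" "z + s *\<^sub>R x"] that
        by (simp add: algebra_simps)
      have "r (y + z) - (m (z + s *\<^sub>R x) - s * m x) \<le> r y" if "s \<ge> 0" for s
        using *[OF _ that] by (intro great) (simp add: algebra_simps)
      then have "r (y + z) - r y \<le> r z"
        by (intro great) (simp add: algebra_simps)
      then show "r (y + z) \<le> r y + r z" by simp
    next
      fix c :: real and y assume c: "c > 0"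
      have "r (c *\<^sub>R y) / c \<le> r y"
      proof (rule great)
        fix t :: real assume t: "t \<ge> 0"
        have "r (c *\<^sub>R y) \<le> m (c *\<^sub>R (y + t *\<^sub>R x)) - (c * t) * m x"
          using low[of "c * t" "c *\<^sub>R y"] c t by (simp add: algebra_simps)
        also have "\<dots> = c * (m (y + t *\<^sub>R x) - t * m x)"
          using sublinear_scale[OF m, of c "y + t *\<^sub>R x"] c
          by (simp add: right_diff_distrib mult.assoc)
        finally show "r (c *\<^sub>R y) / c \<le> m (y + t *\<^sub>R x) - t * m x"
          using c by (simp add: field_simps)
      qed
      then show "r (c *\<^sub>R y) \<le> c * r y"
        using c by (simp add: field_simps)
    qed
    moreover have "r \<le> m"
      using low[of 0] by (simp add: le_fun_def)
    ultimately have "r = m" by (rule minimal)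
    then show ?thesis
      using low[of 1 y] by simp
  qed
  have add: "m (x + y) = m x + m y" for x y
    using super[of x y] sublinear_add[OF m, of x y] by linarith
  have neg: "m (- x) = - m x" for x
    using add[of x "- x"] sublinear_zero[OF m] by simp
  have "m (c *\<^sub>R x) = c *\<^sub>R m x" for c x
  proof (cases "c \<ge> 0")
    case True
    then show ?thesis using sublinear_scale[OF m] by simp
  next
    case False
    then show ?thesis
      using sublinear_scale[OF m, of "- c" x] neg[of "c *\<^sub>R x"] by simp
  qed
  with add show ?thesis by (intro linearI)
qed

theorem hahn_banach_sublinear:
  assumes p: "sublinear p"
  obtains f where "linear f" "f \<le> p"
proof -
  define A where "A = {q. sublinear q \<and> q \<le> p}"
  \<comment> \<open>The order is reversed, so that a maximal element in Zorn's lemma is a minimal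
    sublinear functional below \<open>p\<close>.\<close>
  define P where "P = (\<lambda>q r :: 'a \<Rightarrow> real. r \<le> q)"
  have "\<exists>m\<in>A. \<forall>a\<in>A. P m a \<longrightarrow> a = m"
  proof (rule predicate_Zorn)
    show "partial_order_on A (relation_of P A)"
      by (rule partial_order_on_relation_ofI) (auto simp: P_def)
    fix Q assume "Q \<in> Chains (relation_of P A)"
    then have Q: "\<And>q. q \<in> Q \<Longrightarrow> q \<in> A" "\<And>q r. q \<in> Q \<Longrightarrow> r \<in> Q \<Longrightarrow> q \<le> r \<or> r \<le> q"
      by (auto simp: Chains_def relation_of_def P_def)
    show "\<exists>u\<in>A. \<forall>a\<in>Q. P a u"
    proof (cases "Q = {}")
      case True
      then show ?thesis using p by (intro bexI[of _ p]) (auto simp: A_def)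
    next
      case False
      have Q': "sublinear q \<and> q \<le> p" if "q \<in> Q" for q
        using Q(1)[OF that] by (simp add: A_def)
      note inf = sublinear_cINF[OF False Q' Q(2)]
      obtain q where q: "q \<in> Q" using False by blast
      have le: "(\<lambda>x. INF q\<in>Q. q x) \<le> q" if "q \<in> Q" for q
        using inf(2)[OF _ _ _ that] by (auto simp: le_fun_def)
      show ?thesis
      proof (intro bexI ballI)
        show "(\<lambda>x. INF q\<in>Q. q x) \<in> A"
          using inf(1) order_trans[OF le[OF q]] Q'[OF q] by (simp add: A_def)
      qed (simp add: P_def le)
    qed
  qed
  then obtain m where "m \<in> A" "\<And>a. a \<in> A \<Longrightarrow> a \<le> m \<Longrightarrow> a = m"
    by (auto simp: P_def)
  then have "linear m" "m \<le> p"
    by (auto simp: A_def intro!: minimal_sublinear_linear intro: order_trans)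
  then show ?thesis by (rule that)
qed

section \<open>Separation in locally convex spaces\<close>

lemma vn_bounded_subset: "vn_bounded B \<Longrightarrow> A \<subseteq> B \<Longrightarrow> vn_bounded A"
  unfolding vn_bounded_def by fast

lemma vn_boundedE:
  assumes "vn_bounded B" "open U" "0 \<in> U"
  obtains s where "s > 0" "\<And>b. b \<in> B \<Longrightarrow> inverse s *\<^sub>R b \<in> U"
proof -
  obtain s where s: "s > 0" "B \<subseteq> (\<lambda>x. s *\<^sub>R x) ` U"
    using assms unfolding vn_bounded_def by (meson order_refl)
  show ?thesis
  proof (rule that[OF s(1)])
    fix b assume "b \<in> B"
    then obtain u where "u \<in> U" "b = s *\<^sub>R u" using s(2) by blast
    with s(1) show "inverse s *\<^sub>R b \<in> U" by simp
  qed
qed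

text \<open>If \<open>k\<close> were nonzero, the complement of \<open>{k}\<close> would be a
  neighbourhood of the origin, points being closed. With its absorbing factor \<open>s\<close>, the
  point \<open>s *\<^sub>R k\<close> of the ray is scaled back to \<open>k\<close>, which is
  excluded.\<close>

lemma vn_bounded_ray:
  fixes k :: "'a::hausdorff_lcs"
  assumes "vn_bounded B" "\<And>t. t \<ge> 0 \<Longrightarrow> t *\<^sub>R k \<in> B"
  shows "k = 0"
proof (rule ccontr)
  assume "k \<noteq> 0"
  then have "open (- {k})" "0 \<in> - {k}" by auto
  then obtain s where s: "s > 0" "\<And>b. b \<in> B \<Longrightarrow> inverse s *\<^sub>R b \<in> - {k}"
    using vn_boundedE[OF assms(1)] by blast
  from s(2)[OF assms(2)[of s]] s(1) show False by simp
qed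

lemma linear_continuous_if_le_1:
  fixes f :: "'a::hausdorff_lcs \<Rightarrow> real"
  assumes f: "linear f" and V: "open V" "0 \<in> V" and le: "\<And>v. v \<in> V \<Longrightarrow> f v \<le> 1"
  shows "continuous_on UNIV f"
  unfolding continuous_on_def
proof
  fix x
  show "(f \<longlongrightarrow> f x) (at x)"
  proof (rule tendstoI)
    fix e :: real assume e: "e > 0"
    have lim: "((\<lambda>y. c *\<^sub>R (y - x)) \<longlongrightarrow> 0) (at x)" for c
    proof -
      have "((\<lambda>y. c *\<^sub>R (y - x)) \<longlongrightarrow> c *\<^sub>R (x - x)) (at x)"
        by (intro tendsto_scaleR_lcs tendsto_intros)
      then show ?thesis by simp
    qed
    \<comment> \<open>\<open>V\<close> need not be symmetric, hence both signs. The factor 2 leaves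
      room for the strict bound.\<close>
    have "eventually (\<lambda>y. (2 / e) *\<^sub>R (y - x) \<in> V) (at x)"
        "eventually (\<lambda>y. (- (2 / e)) *\<^sub>R (y - x) \<in> V) (at x)"
      using topological_tendstoD[OF lim V] by blast+
    then show "eventually (\<lambda>y. dist (f y) (f x) < e) (at x)"
    proof eventually_elim
      case (elim y)
      have "(2 / e) * f (y - x) \<le> 1" "- (2 / e) * f (y - x) \<le> 1"
        using le[OF elim(1)] le[OF elim(2)]
        unfolding linear_scale[OF f] by simp_all
      then have "2 * \<bar>f (y - x)\<bar> \<le> e"
        using e by (simp add: field_simps abs_if)
      then show ?case
        using e by (simp add: dist_real_def linear_diff[OF f])
    qed
  qed
qed

text \<open>The Hahn--Banach theorem is applied to a sublinear \<open>p\<close> with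
  \<open>p \<le> 1\<close> on a convex neighbourhood \<open>V\<close> of the origin that misses
  \<open>A\<close>, and \<open>p (- a) \<le> - 1\<close> for \<open>a \<in> A\<close>. The first
  bound makes a linear \<open>f \<le> p\<close> continuous, the second gives
  \<open>f a \<ge> 1\<close>.\<close>

theorem separation_from_zero:
  fixes A :: "'a::hausdorff_lcs set"
  assumes A: "convex A" "0 \<notin> closure A"
  obtains f where "\<And>a. a \<in> A \<Longrightarrow> dual_apply f a \<ge> 1"
proof (cases "A = {}")
  case True
  then show ?thesis using that[of 0] by simp
next
  case False
  then obtain a0 where a0: "a0 \<in> A" by blast
  have "open (- closure A)" "0 \<in> - closure A" using A by auto
  then obtain V where V: "open V" "0 \<in> V" "convex V" "V \<subseteq> - closure A"
    using locally_convex_lcs by blast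
  have disj: "a \<notin> V" if "a \<in> A" for a
    using V(4) closure_subset[of A] that by blast
  have absorb: "\<exists>s>0. \<exists>v\<in>V. x = s *\<^sub>R v" for x
  proof -
    obtain s where "s > 0" "inverse s *\<^sub>R x \<in> V"
      using vn_boundedE[OF vn_bounded_singleton[of x] V(1,2)] by blast
    then show ?thesis by (intro exI[of _ s] conjI bexI[of _ "inverse s *\<^sub>R x"]) auto
  qed
  have combine: "\<exists>w\<in>C. s *\<^sub>R v + r *\<^sub>R u = (s + r) *\<^sub>R w"
    if "convex C" "u \<in> C" "v \<in> C" "s \<ge> 0" "r \<ge> 0" for C and u v :: 'a and s r :: real
  proof (cases "s + r = 0")
    case True
    then have "s = 0" "r = 0" using that by auto
    then show ?thesis using that by auto
  next
    case False
    then have "s + r > 0" using that by auto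
    then have "(s / (s + r)) *\<^sub>R v + (r / (s + r)) *\<^sub>R u \<in> C"
      using that by (intro convexD) (auto simp flip: add_divide_distrib)
    then show ?thesis
      using \<open>s + r > 0\<close> by (intro bexI) (auto simp: scaleR_add_right)
  qed
  \<comment> \<open>The infimum \<open>p x\<close> of \<open>D x\<close> is the infimum, over
    \<open>t \<ge> 0\<close> and \<open>a \<in> A\<close>, of the Minkowski gauge of
    \<open>V\<close> at \<open>x + t *\<^sub>R a\<close> minus \<open>t\<close>.\<close>
  define D where "D = (\<lambda>x. {s - t | s t a v. s > 0 \<and> t \<ge> 0 \<and> a \<in> A \<and> v \<in> V \<and> x + t *\<^sub>R a = s *\<^sub>R v})"
  define p where "p = (\<lambda>x. Inf (D x))"
  have DI: "s - t \<in> D x" if "s > 0" "t \<ge> 0" "a \<in> A" "v \<in> V" "x + t *\<^sub>R a = s *\<^sub>R v" for s t a v x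
    using that unfolding D_def by blast
  have ne: "D x \<noteq> {}" for x
  proof -
    obtain s v where "s > 0" "v \<in> V" "x = s *\<^sub>R v" using absorb by blast
    then show ?thesis using DI[of s 0 a0 v x] a0 by auto
  qed
  have bdd: "bdd_below (D x)" for x
  proof -
    obtain r u where r: "r > 0" "u \<in> V" "- x = r *\<^sub>R u" using absorb by blast
    show ?thesis
    proof (rule bdd_belowI)
      fix d assume "d \<in> D x"
      then obtain s t a v where d: "d = s - t" "s > 0" "t \<ge> 0" "a \<in> A" "v \<in> V" "x + t *\<^sub>R a = s *\<^sub>R v"
        unfolding D_def by blast
      obtain w where w: "w \<in> V" "s *\<^sub>R v + r *\<^sub>R u = (s + r) *\<^sub>R w"
        using combine[OF V(3) r(2) d(5), of s r] d r by auto
      have ta: "t *\<^sub>R a = (s + r) *\<^sub>R w"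
        using w(2) d(6) r(3) by (metis add_diff_cancel_left' diff_conv_add_uminus)
      show "- r \<le> d"
      proof (rule ccontr)
        assume "\<not> - r \<le> d"
        then have t: "t > s + r" using d by simp
        \<comment> \<open>Since \<open>t > s + r\<close>, this is a convex combination of
          \<open>w\<close> and the origin, so \<open>a\<close> would lie in \<open>V\<close>.
          Disjointness of \<open>V\<close> and \<open>A\<close> is thus what keeps \<open>p\<close>
          finite.\<close>
        then have "a = ((s + r) / t) *\<^sub>R w + (1 - (s + r) / t) *\<^sub>R 0"
          using ta d r by (simp add: field_simps eq_vector_fraction_iff)
        also have "\<dots> \<in> V"
          using t d r w V by (intro convexD) (auto simp: field_simps)
        finally show False using disj[OF d(4)] by blast
      qed
    qed
  qed
  have low: "p x \<le> d" if "d \<in> D x" for d x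
    unfolding p_def by (rule cInf_lower[OF that bdd])
  have great: "c \<le> p x" if "\<And>d. d \<in> D x \<Longrightarrow> c \<le> d" for c x
    unfolding p_def by (rule cInf_greatest[OF ne that])
  have "sublinear p"
    unfolding sublinear_def
  proof (intro conjI allI impI)
    fix x y
    have *: "p (x + y) \<le> d + e" if dD: "d \<in> D x" and eD: "e \<in> D y" for d e
    proof -
      obtain s t a v where d: "d = s - t" "s > 0" "t \<ge> 0" "a \<in> A" "v \<in> V" "x + t *\<^sub>R a = s *\<^sub>R v"
        using dD unfolding D_def by blast
      obtain s' t' a' v' where e: "e = s' - t'" "s' > 0" "t' \<ge> 0" "a' \<in> A" "v' \<in> V"
          "y + t' *\<^sub>R a' = s' *\<^sub>R v'"
        using eD unfolding D_def by blast
      obtain b where b: "b \<in> A" "t *\<^sub>R a + t' *\<^sub>R a' = (t + t') *\<^sub>R b"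
        using combine[OF A(1) e(4) d(4), of t t'] d e by auto
      obtain w where w: "w \<in> V" "s *\<^sub>R v + s' *\<^sub>R v' = (s + s') *\<^sub>R w"
        using combine[OF V(3) e(5) d(5), of s s'] d e by auto
      have "(x + y) + (t + t') *\<^sub>R b = (s + s') *\<^sub>R w"
        unfolding b(2)[symmetric] w(2)[symmetric] d(6)[symmetric] e(6)[symmetric]
        by (simp add: algebra_simps)
      then have "(s + s') - (t + t') \<in> D (x + y)"
        using d e b w by (intro DI) auto
      from low[OF this] show ?thesis using d e by simp
    qed
    have "p (x + y) - e \<le> p x" if "e \<in> D y" for e
      using *[OF _ that] by (intro great) (simp add: algebra_simps)
    then have "p (x + y) - p x \<le> p y"
      by (intro great) (simp add: algebra_simps)
    then show "p (x + y) \<le> p x + p y" by simp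
  next
    fix c :: real and x assume c: "c > 0"
    have "p (c *\<^sub>R x) / c \<le> p x"
    proof (rule great)
      fix d assume "d \<in> D x"
      then obtain s t a v where d: "d = s - t" "s > 0" "t \<ge> 0" "a \<in> A" "v \<in> V" "x + t *\<^sub>R a = s *\<^sub>R v"
        unfolding D_def by blast
      have "c *\<^sub>R x + (c * t) *\<^sub>R a = (c * s) *\<^sub>R v"
        using arg_cong[OF d(6), of "(*\<^sub>R) c"] by (simp add: algebra_simps)
      then have "c * s - c * t \<in> D (c *\<^sub>R x)"
        using d c by (intro DI) auto
      from low[OF this] have "p (c *\<^sub>R x) \<le> d * c"
        unfolding d(1) by (simp add: algebra_simps)
      then show "p (c *\<^sub>R x) / c \<le> d"
        using c by (simp add: pos_divide_le_eq)
    qed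
    then show "p (c *\<^sub>R x) \<le> c * p x" using c by (simp add: field_simps)
  qed
  then obtain f where f: "linear f" "f \<le> p" by (rule hahn_banach_sublinear)
  have "f v \<le> 1" if "v \<in> V" for v
    using low[OF DI[of 1 0 a0 v v]] a0 that le_funD[OF f(2), of v] by simp
  then have "continuous_on UNIV f"
    by (rule linear_continuous_if_le_1[OF f(1) V(1,2)])
  then have app: "dual_apply (Dual f) = f"
    using f(1) by (simp add: Dual_inverse)
  have "f a \<ge> 1" if "a \<in> A" for a
  proof (rule field_le_epsilon)
    fix e :: real assume "e > 0"
    \<comment> \<open>The element of \<open>D (- a)\<close> comes from
      \<open>- a + 1 *\<^sub>R a = e *\<^sub>R 0\<close>. The factor \<open>s\<close> must be
      positive, hence the slack \<open>e\<close>.\<close>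
    then have "p (- a) \<le> e - 1"
      using low[OF DI[of e 1 a 0 "- a"]] that V by simp
    then show "1 \<le> f a + e"
      using le_funD[OF f(2), of "- a"] linear_neg[OF f(1), of a] by simp
  qed
  then show ?thesis using that[of "Dual f"] by (simp add: app)
qed

section \<open>The weak topology\<close>

lemma open_dual_less: "open {x. dual_apply f x < c}"
  by (intro open_Collect_less continuous_intros continuous_on_dual_apply)

lemma dual_apply_linear [simp]:
  "dual_apply f 0 = 0" "dual_apply f (x + y) = dual_apply f x + dual_apply f y"
  "dual_apply f (x - y) = dual_apply f x - dual_apply f y"
  "dual_apply f (- x) = - dual_apply f x" "dual_apply f (t *\<^sub>R x) = t * dual_apply f x"
  by (simp_all add: linear_0 linear_add linear_diff linear_neg linear_scale linear_dual_apply)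

lemma convex_dual_ge: "convex {x. c \<le> dual_apply f x}"
  using convex_linear_vimage[OF linear_dual_apply[of f] convex_real_interval(1)[of c]]
  by (simp add: vimage_def)

lemma openin_weak_vimage: "open V \<Longrightarrow> openin weak_topology (dual_apply f -` V)"
  unfolding weak_topology_def by (rule topology_generated_by_Basis) blast

text \<open>By induction on the generation of the topology: an intersection of two sets takes the
  union of the two families and the smaller radius.\<close>

lemma openin_weak_basic:
  assumes "openin weak_topology W" "x \<in> W"
  obtains F e where "finite F" "e > 0"
    "{y. \<forall>f\<in>F. \<bar>dual_apply f y - dual_apply f x\<bar> < e} \<subseteq> W"
proof -
  have "generate_topology_on {dual_apply f -` V | f V. open V} W"
    using assms(1) unfolding weak_topology_def by (simp add: openin_topology_generated_by_iff)
  then have "x \<in> W \<longrightarrow> (\<exists>F e. finite F \<and> e > 0 \<and>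
      {y. \<forall>f\<in>F. \<bar>dual_apply f y - dual_apply f x\<bar> < e} \<subseteq> W)"
  proof induction
    case (Int S T)
    show ?case
    proof
      assume "x \<in> S \<inter> T"
      with Int.IH obtain F d G e where *: "finite F" "d > 0"
        "{y. \<forall>f\<in>F. \<bar>dual_apply f y - dual_apply f x\<bar> < d} \<subseteq> S" "finite G" "e > 0"
        "{y. \<forall>f\<in>G. \<bar>dual_apply f y - dual_apply f x\<bar> < e} \<subseteq> T" by blast
      then show "\<exists>F e. finite F \<and> e > 0 \<and>
          {y. \<forall>f\<in>F. \<bar>dual_apply f y - dual_apply f x\<bar> < e} \<subseteq> S \<inter> T"
        by (intro exI[of _ "F \<union> G"] exI[of _ "min d e"]) (auto simp: subset_iff)
    qed
  next
    case (UN K)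
    then show ?case by (meson Union_iff Union_upper order_trans)
  next
    case (Basis S)
    then obtain f V where S: "S = dual_apply f -` V" "open V" by blast
    show ?case
    proof
      assume "x \<in> S"
      with S obtain e where "e > 0" "ball (dual_apply f x) e \<subseteq> V"
        using open_contains_ball by blast
      then show "\<exists>F e. finite F \<and> e > 0 \<and>
          {y. \<forall>f\<in>F. \<bar>dual_apply f y - dual_apply f x\<bar> < e} \<subseteq> S"
        using S by (intro exI[of _ "{f}"] exI[of _ e]) (auto simp: dist_real_def abs_minus_commute subset_iff)
    qed
  qed simp
  with assms(2) that show ?thesis by blast
qed

lemma open_if_openin_weak:
  assumes "openin weak_topology W"
  shows "open W"
proof (subst open_subopen, intro ballI)
  fix x assume "x \<in> W"
  then obtain F e where F: "finite F" "e > 0"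
    "{y. \<forall>f\<in>F. \<bar>dual_apply f y - dual_apply f x\<bar> < e} \<subseteq> W"
    using openin_weak_basic[OF assms] by blast
  have "open (\<Inter>f\<in>F. {y. \<bar>dual_apply f y - dual_apply f x\<bar> < e})"
    using F(1) by (intro open_INT ballI open_Collect_less continuous_intros continuous_on_dual_apply)
  then show "\<exists>T. open T \<and> x \<in> T \<and> T \<subseteq> W"
    using F by (intro exI[of _ "\<Inter>f\<in>F. {y. \<bar>dual_apply f y - dual_apply f x\<bar> < e}"]) auto
qed

lemma bounded_pts_of_continuity_0E:
  assumes "0 \<in> bounded_pts_of_continuity K"
  obtains W where "openin weak_topology W" "0 \<in> W" "vn_bounded (W \<inter> K)"
proof -
  obtain W V where "openin weak_topology V" "0 \<in> V" "V \<subseteq> W" "vn_bounded (W \<inter> K)"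
    using assms by (auto simp: bounded_pts_of_continuity_def neighbourhoods_def)
  then show ?thesis
    using that[of V] vn_bounded_subset[of "W \<inter> K" "V \<inter> K"] by blast
qed

section \<open>Consequences of the weak property\<close>

lemma convex_coneD:
  assumes "convex_cone K"
  shows "0 \<in> K" "convex K" "\<And>x y. x \<in> K \<Longrightarrow> y \<in> K \<Longrightarrow> x + y \<in> K"
    "\<And>t x. t \<ge> 0 \<Longrightarrow> x \<in> K \<Longrightarrow> t *\<^sub>R x \<in> K"
  using assms convex_cone_contains_0[OF assms] convex_cone_add[OF assms] convex_cone_scaleR[OF assms]
  by (auto simp: convex_cone_def)

lemma dual_coneD: "f \<in> dual_cone K \<Longrightarrow> k \<in> K \<Longrightarrow> dual_apply f k \<ge> 0"
  by (auto simp: dual_cone_def)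

text \<open>By homogeneity, \<open>s\<close> times the slice of \<open>K\<close> below
  \<open>\<alpha> / s\<close> lies in the bounded slice, which \<open>s\<close> scales into
  \<open>U\<close>. So the slices of \<open>K\<close> by a single functional form a base of
  neighbourhoods of the origin in \<open>K\<close>.\<close>

lemma weak_property_pi_slices:
  assumes K: "convex_cone K" and "weak_property_pi K"
  obtains f \<alpha> where "f \<in> dual_cone K" "\<alpha> > 0" "vn_bounded (K \<inter> {x. dual_apply f x < \<alpha>})"
    "\<And>U. open U \<Longrightarrow> 0 \<in> U \<Longrightarrow> \<exists>\<delta>>0. K \<inter> {x. dual_apply f x < \<delta>} \<subseteq> U"
proof -
  obtain f \<alpha> where f: "f \<in> dual_cone K" "\<alpha> > 0" "vn_bounded (K \<inter> {x. dual_apply f x \<le> \<alpha>})"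
    using assms(2) unfolding weak_property_pi_def by blast
  show ?thesis
  proof (rule that[OF f(1,2)])
    show "vn_bounded (K \<inter> {x. dual_apply f x < \<alpha>})"
      by (rule vn_bounded_subset[OF f(3)]) auto
    fix U :: "'a set" assume "open U" "0 \<in> U"
    then obtain s where s: "s > 0" "\<And>b. b \<in> K \<inter> {x. dual_apply f x \<le> \<alpha>} \<Longrightarrow> inverse s *\<^sub>R b \<in> U"
      using vn_boundedE[OF f(3)] by blast
    have "x \<in> U" if "x \<in> K" "dual_apply f x < \<alpha> / s" for x
    proof -
      have "s *\<^sub>R x \<in> K \<inter> {x. dual_apply f x \<le> \<alpha>}"
        using that s(1) convex_coneD(4)[OF K] by (auto simp: field_simps)
      from s(2)[OF this] s(1) show ?thesis by simp
    qed
    then show "\<exists>\<delta>>0. K \<inter> {x. dual_apply f x < \<delta>} \<subseteq> U"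
      using f(2) s(1) by (intro exI[of _ "\<alpha> / s"]) auto
  qed
qed

lemma weak_property_pi_imp_bPC:
  assumes K: "convex_cone K" and "weak_property_pi K"
  shows "0 \<in> bounded_pts_of_continuity K"
proof -
  obtain f \<alpha> where f: "\<alpha> > 0" "vn_bounded (K \<inter> {x. dual_apply f x < \<alpha>})"
    and sl: "\<And>U. open U \<Longrightarrow> 0 \<in> U \<Longrightarrow> \<exists>\<delta>>0. K \<inter> {x. dual_apply f x < \<delta>} \<subseteq> U"
    using weak_property_pi_slices[OF assms] by metis
  have nb: "{x. dual_apply f x < \<delta>} \<in> neighbourhoods weak_topology 0" if "\<delta> > 0" for \<delta>
    using openin_weak_vimage[of "{..<\<delta>}" f] that
    by (auto simp: neighbourhoods_def vimage_def intro!: exI[of _ "{x. dual_apply f x < \<delta>}"])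
  show ?thesis
    unfolding bounded_pts_of_continuity_def pts_of_continuity_def
  proof (intro CollectI conjI ballI)
    show "0 \<in> K" by (rule convex_coneD[OF K])
    show "\<exists>W\<in>neighbourhoods weak_topology 0. vn_bounded (W \<inter> K)"
      using f nb by (intro bexI[of _ "{x. dual_apply f x < \<alpha>}"]) (auto simp: Int_commute)
    fix U :: "'a set" assume "U \<in> neighbourhoods euclidean 0"
    then obtain V where "open V" "0 \<in> V" "V \<subseteq> U" by (auto simp: neighbourhoods_def)
    with sl[of V] obtain \<delta> where "\<delta> > 0" "K \<inter> {x. dual_apply f x < \<delta>} \<subseteq> U" by blast
    then show "\<exists>W\<in>neighbourhoods weak_topology 0. W \<inter> K \<subseteq> U"
      using nb by (intro bexI[of _ "{x. dual_apply f x < \<delta>}"]) auto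
  qed
qed

text \<open>The complement of a small slice is a closed half-space; it contains \<open>K - U\<close>
  and hence the closed convex hull of that set, but not the origin.\<close>

lemma weak_property_pi_imp_denting:
  assumes K: "convex_cone K" and "weak_property_pi K"
  shows "0 \<in> denting_points K"
proof -
  obtain f where sl: "\<And>U. open U \<Longrightarrow> 0 \<in> U \<Longrightarrow> \<exists>\<delta>>0. K \<inter> {x. dual_apply f x < \<delta>} \<subseteq> U"
    using weak_property_pi_slices[OF assms] by metis
  show ?thesis
    unfolding denting_points_def
  proof (intro CollectI conjI ballI)
    show "0 \<in> K" by (rule convex_coneD[OF K])
    fix U :: "'a set" assume "U \<in> neighbourhoods euclidean 0"
    then obtain V where "open V" "0 \<in> V" "V \<subseteq> U" by (auto simp: neighbourhoods_def)
    with sl[of V] obtain \<delta> where d: "\<delta> > 0" "K \<inter> {x. dual_apply f x < \<delta>} \<subseteq> U" by blast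
    let ?H = "- {x. dual_apply f x < \<delta>}"
    have "convex ?H"
      using convex_dual_ge[of \<delta> f] by (simp add: Collect_neg_eq[symmetric] not_less)
    moreover have "K - U \<subseteq> ?H" using d by auto
    ultimately have "closure (convex hull (K - U)) \<subseteq> ?H"
      by (intro closure_minimal hull_minimal closed_Compl open_dual_less)
    then show "0 \<notin> closure (convex hull (K - U))" using d by auto
  qed
qed

text \<open>As \<open>f\<close> is nonnegative at \<open>c'\<close>, its value at \<open>c\<close>
  is at most twice its value at the midpoint. This forces \<open>c\<close> into small slices, and
  gives convergence even for the original topology.\<close>

lemma weak_property_pi_imp_s_ext:
  assumes K: "convex_cone K" and "weak_property_pi K"
  shows "0 \<in> weak_s_ext K"
proof -
  obtain f where f: "f \<in> dual_cone K"
    and sl: "\<And>U. open U \<Longrightarrow> 0 \<in> U \<Longrightarrow> \<exists>\<delta>>0. K \<inter> {x. dual_apply f x < \<delta>} \<subseteq> U"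
    using weak_property_pi_slices[OF assms] by metis
  show ?thesis
    unfolding weak_s_ext_def
  proof (intro CollectI conjI allI impI)
    show "0 \<in> K" by (rule convex_coneD[OF K])
    fix \<Gamma> :: "'a set set" and r c c'
    assume asm: "directed_set \<Gamma> r \<and> (\<forall>\<gamma>\<in>\<Gamma>. c \<gamma> \<in> K \<and> c' \<gamma> \<in> K) \<and>
      limitin euclidean (\<lambda>\<gamma>. midpoint (c \<gamma>) (c' \<gamma>)) 0 (tails \<Gamma> r)"
    show "limitin weak_topology c 0 (tails \<Gamma> r)"
      unfolding limitin_def
    proof (intro conjI allI impI)
      fix W :: "'a set" assume W: "openin weak_topology W \<and> 0 \<in> W"
      then obtain \<delta> where d: "\<delta> > 0" "K \<inter> {x. dual_apply f x < \<delta>} \<subseteq> W"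
        using sl[of W] open_if_openin_weak by blast
      have "open {x. dual_apply f x < \<delta> / 2}" "0 \<in> {x. dual_apply f x < \<delta> / 2}"
        using d by (simp_all only: open_dual_less mem_Collect_eq dual_apply_linear)
      then have "eventually (\<lambda>\<gamma>. midpoint (c \<gamma>) (c' \<gamma>) \<in> {x. dual_apply f x < \<delta> / 2}) (tails \<Gamma> r)"
        using asm unfolding limitin_def by (metis open_openin)
      moreover have "eventually (\<lambda>\<gamma>. c \<gamma> \<in> K \<and> c' \<gamma> \<in> K) (tails \<Gamma> r)"
        using asm by (auto simp: eventually_tails directed_set_def)
      ultimately show "eventually (\<lambda>\<gamma>. c \<gamma> \<in> W) (tails \<Gamma> r)"
      proof eventually_elim
        case (elim \<gamma>)
        have "dual_apply f (c \<gamma>) < \<delta>"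
          using elim dual_coneD[OF f, of "c' \<gamma>"] by (simp add: midpoint_def field_simps)
        with elim d show ?case by blast
      qed
    qed simp
  qed
qed

section \<open>Sufficient conditions for the weak property\<close>

text \<open>Separating the origin from the convex hull of \<open>K - W\<close> gives
  \<open>f \<ge> 1\<close> on \<open>K\<close> outside \<open>W\<close>, so the slice
  \<open>f < 1\<close> of \<open>K\<close> is contained in the bounded set
  \<open>W \<inter> K\<close>.\<close>

lemma weak_property_piI_denting:
  assumes K: "convex_cone K" and bpc: "0 \<in> bounded_pts_of_continuity K"
    and dp: "0 \<in> denting_points K"
  shows "weak_property_pi K"
proof -
  obtain W where W: "openin weak_topology W" "0 \<in> W" "vn_bounded (W \<inter> K)"
    using bpc by (rule bounded_pts_of_continuity_0E)
  have "W \<in> neighbourhoods euclidean 0"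
    using W open_if_openin_weak by (auto simp: neighbourhoods_def)
  then have "0 \<notin> closure (convex hull (K - W))"
    using dp by (auto simp: denting_points_def)
  then obtain f where f: "\<And>a. a \<in> convex hull (K - W) \<Longrightarrow> dual_apply f a \<ge> 1"
    using separation_from_zero[OF convex_convex_hull] by blast
  have in_W: "x \<in> W" if "x \<in> K" "dual_apply f x < 1" for x
    using f[OF hull_inc, of x] that by force
  have "f \<in> dual_cone K"
    unfolding dual_cone_def
  proof (intro CollectI ballI, rule ccontr)
    fix k assume k: "k \<in> K" "\<not> 0 \<le> dual_apply f k"
    \<comment> \<open>A negative value at \<open>k\<close> would keep the whole ray through
      \<open>k\<close> in the slice \<open>f < 1\<close>, which is bounded.\<close>
    have "t *\<^sub>R k \<in> W \<inter> K" if "t \<ge> 0" for t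
    proof -
      have "t * dual_apply f k \<le> 0"
        using k(2) that by (simp add: mult_nonneg_nonpos)
      then show ?thesis
        using in_W[of "t *\<^sub>R k"] convex_coneD(4)[OF K that k(1)] by simp
    qed
    then have "k = 0" by (rule vn_bounded_ray[OF W(3)])
    with k(2) show False by simp
  qed
  \<comment> \<open>The level \<open>1/2\<close> passes from the strict inequality
    \<open>f < 1\<close> to the non-strict one of the weak property.\<close>
  moreover have "vn_bounded (K \<inter> {x. dual_apply f x \<le> 1/2})"
    using in_W by (intro vn_bounded_subset[OF W(3)]) force
  ultimately show ?thesis
    unfolding weak_property_pi_def by (intro bexI[of _ f] exI[of _ "1/2"]) auto
qed

section \<open>Finite families in the dual cone and the span of the dual cone\<close>

lemma dual_cone_sum: "(\<And>i. i \<in> I \<Longrightarrow> g i \<in> dual_cone K) \<Longrightarrow> sum g I \<in> dual_cone K"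
  by (induction I rule: infinite_finite_induct) (auto simp: dual_cone_def)

lemma dual_apply_sum: "dual_apply (sum g I) x = (\<Sum>i\<in>I. dual_apply (g i) x)"
  by (induction I rule: infinite_finite_induct) auto

text \<open>On \<open>K\<close> each member of \<open>G\<close> is nonnegative, hence bounded by the
  sum of all. The slice of \<open>K\<close> by the sum at height \<open>l / 2\<close> therefore lies
  in the given bounded set.\<close>

lemma weak_property_piI_finite:
  assumes G: "finite G" "G \<subseteq> dual_cone K" and l: "l > 0"
    and bd: "vn_bounded (K \<inter> {x. \<forall>g\<in>G. dual_apply g x < l})"
  shows "weak_property_pi K"
proof -
  have "vn_bounded (K \<inter> {x. dual_apply (\<Sum>g\<in>G. g) x \<le> l / 2})"
  proof (rule vn_bounded_subset[OF bd], safe)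
    fix x g assume x: "x \<in> K" "dual_apply (\<Sum>g\<in>G. g) x \<le> l / 2" and g: "g \<in> G"
    have "dual_apply g x \<le> (\<Sum>g\<in>G. dual_apply g x)"
      using g G x by (intro member_le_sum) (auto intro: dual_coneD)
    then show "dual_apply g x < l"
      using x l by (simp add: dual_apply_sum)
  qed
  moreover have "(\<Sum>g\<in>G. g) \<in> dual_cone K"
    using G by (intro dual_cone_sum) auto
  ultimately show ?thesis
    unfolding weak_property_pi_def using l by (intro bexI[of _ "\<Sum>g\<in>G. g"] exI[of _ "l/2"]) auto
qed

text \<open>The dual cone is closed under sums and nonnegative multiples; a term with a negative
  coefficient is moved to the subtracted part \<open>h\<close>.\<close>

lemma span_dual_coneE:
  assumes "s \<in> span (dual_cone K)"
  obtains g h where "g \<in> dual_cone K" "h \<in> dual_cone K" "s = g - h"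
proof -
  have "\<exists>g\<in>dual_cone K. \<exists>h\<in>dual_cone K. s = g - h"
    using assms
  proof (induction rule: span_induct_alt)
    case base
    show ?case by (intro bexI[of _ 0]) (auto simp: dual_cone_def)
  next
    case (step c x y)
    then obtain g h where gh: "g \<in> dual_cone K" "h \<in> dual_cone K" "y = g - h" by blast
    show ?case
    proof (cases "c \<ge> 0")
      case True
      with step gh show ?thesis
        by (intro bexI[of _ "c *\<^sub>R x + g"] bexI[of _ h]) (auto simp: dual_cone_def)
    next
      case False
      have "c * dual_apply x k \<le> dual_apply h k" if "k \<in> K" for k
      proof -
        have "c * dual_apply x k \<le> 0"
          using False dual_coneD[OF step(1) that] by (simp add: mult_nonpos_nonneg)
        also have "0 \<le> dual_apply h k"
          by (rule dual_coneD[OF gh(2) that])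
        finally show ?thesis .
      qed
      then have "(- c) *\<^sub>R x + h \<in> dual_cone K"
        by (simp add: dual_cone_def)
      moreover have "c *\<^sub>R x + y = g - ((- c) *\<^sub>R x + h)"
        using gh by simp
      ultimately show ?thesis using gh by blast
    qed
  qed
  with that show ?thesis by blast
qed

lemma weak_property_piI_dense_span:
  assumes K: "convex_cone K" and bpc: "0 \<in> bounded_pts_of_continuity K"
    and dense: "closure (span (dual_cone K)) = UNIV"
  shows "weak_property_pi K"
proof -
  obtain W where W: "openin weak_topology W" "0 \<in> W" "vn_bounded (W \<inter> K)"
    using bpc by (rule bounded_pts_of_continuity_0E)
  obtain F e where F: "finite F" "e > 0" "{y. \<forall>f\<in>F. \<bar>dual_apply f y\<bar> < e} \<subseteq> W"
    using openin_weak_basic[OF W(1,2)] by auto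
  define B where "B = K \<inter> {y. \<forall>f\<in>F. \<bar>dual_apply f y\<bar> < e}"
  have B: "vn_bounded B"
    using F by (intro vn_bounded_subset[OF W(3)]) (auto simp: B_def)
  \<comment> \<open>The error \<open>e / 4\<close> and the bound \<open>e / 4\<close> on the
    difference of \<open>g\<close> and \<open>h\<close> will together stay below
    \<open>e / 2\<close>, the value of \<open>\<bar>f\<bar>\<close> at the rescaled point.
    \<open>B\<close> is bounded, so density for uniform convergence on bounded sets applies.\<close>
  have "\<exists>g h. g \<in> dual_cone K \<and> h \<in> dual_cone K \<and>
      (\<forall>x\<in>B. \<bar>dual_apply (g - h) x - dual_apply f x\<bar> < e / 4)" for f
  proof -
    have "eventually (\<lambda>s. \<forall>x\<in>B. \<bar>dual_apply s x - dual_apply f x\<bar> < e / 4) (nhds f)"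
      unfolding eventually_nhds_dual using B F(2) by (intro exI[of _ B] exI[of _ "e / 4"]) auto
    then obtain S where S: "open S" "f \<in> S"
        "\<And>s. s \<in> S \<Longrightarrow> \<forall>x\<in>B. \<bar>dual_apply s x - dual_apply f x\<bar> < e / 4"
      unfolding eventually_nhds by blast
    have "f \<in> closure (span (dual_cone K))" using dense by simp
    then obtain s where "s \<in> span (dual_cone K)" "s \<in> S"
      using S open_Int_closure_eq_empty[of S "span (dual_cone K)"] by blast
    then show ?thesis using S(3) by (metis span_dual_coneE)
  qed
  then obtain g h where gh: "\<And>f. g f \<in> dual_cone K" "\<And>f. h f \<in> dual_cone K"
    "\<And>f x. x \<in> B \<Longrightarrow> \<bar>dual_apply (g f - h f) x - dual_apply f x\<bar> < e / 4"
    by metis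
  show ?thesis
  proof (rule weak_property_piI_finite)
    show "finite (g ` F \<union> h ` F)" "g ` F \<union> h ` F \<subseteq> dual_cone K" "e / 4 > 0"
      using F gh by auto
    show "vn_bounded (K \<inter> {x. \<forall>u\<in>g ` F \<union> h ` F. dual_apply u x < e / 4})"
    proof (rule vn_bounded_subset[OF B], rule subsetI, rule ccontr)
      fix k assume k: "k \<in> K \<inter> {x. \<forall>u\<in>g ` F \<union> h ` F. dual_apply u x < e / 4}" and "k \<notin> B"
      then obtain f0 where f0: "f0 \<in> F" "\<bar>dual_apply f0 k\<bar> \<ge> e"
        by (force simp: B_def)
      \<comment> \<open>The functional with the largest absolute value at \<open>k\<close> is
        singled out, so that one scaling factor controls all of \<open>F\<close>.\<close>
      define M where "M = Max ((\<lambda>f. \<bar>dual_apply f k\<bar>) ` F)"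
      have "M \<in> (\<lambda>f. \<bar>dual_apply f k\<bar>) ` F"
        unfolding M_def using F f0 by (intro Max_in) auto
      then obtain f where f: "f \<in> F" "M = \<bar>dual_apply f k\<bar>" by blast
      have le: "\<bar>dual_apply u k\<bar> \<le> M" if "u \<in> F" for u
        unfolding M_def using F that by (intro Max_ge) auto
      have M: "M \<ge> e" using le[OF f0(1)] f0(2) by simp
      txt \<open>The multiple \<open>t *\<^sub>R k\<close>, at which the maximum is \<open>e / 2\<close>, lies in the set on which
        \<open>g f - h f\<close> approximates \<open>f\<close>.\<close>
      define t where "t = e / (2 * M)"
      have t: "0 < t" "t \<le> 1" "t * M = e / 2"
        using F(2) M by (auto simp: t_def field_simps)
      have tB: "t *\<^sub>R k \<in> B"
        unfolding B_def
      proof (intro IntI CollectI ballI)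
        show "t *\<^sub>R k \<in> K" using k t convex_coneD(4)[OF K] by auto
        fix u assume "u \<in> F"
        then have "t * \<bar>dual_apply u k\<bar> \<le> t * M"
          using le t by (intro mult_left_mono) auto
        then show "\<bar>dual_apply u (t *\<^sub>R k)\<bar> < e"
          using t F(2) by (simp add: abs_mult)
      qed
      have small: "0 \<le> t * dual_apply u k" "t * dual_apply u k < e / 4" if "u \<in> {g f, h f}" for u
      proof -
        have u: "0 \<le> dual_apply u k" "dual_apply u k < e / 4"
          using that k f dual_coneD[OF gh(1), of k] dual_coneD[OF gh(2), of k] by auto
        then show "0 \<le> t * dual_apply u k" using t by simp
        have "t * dual_apply u k \<le> dual_apply u k"
          using u t by (simp add: mult_left_le_one_le)
        with u show "t * dual_apply u k < e / 4" by simp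
      qed
      have "\<bar>dual_apply f (t *\<^sub>R k)\<bar> = e / 2"
        using f t by (simp add: abs_mult)
      \<comment> \<open>Both values are nonnegative, so the difference obeys the same bound as each
        of them, without doubling.\<close>
      moreover have "\<bar>a - b\<bar> < e / 4" if "0 \<le> a" "a < e / 4" "0 \<le> b" "b < e / 4" for a b
        using that by linarith
      then have "\<bar>dual_apply (g f - h f) (t *\<^sub>R k)\<bar> < e / 4"
        using small[of "g f"] small[of "h f"] by simp
      ultimately show False using gh(3)[OF tB, of f] by linarith
    qed
  qed
qed

section \<open>Normality and the bidual cone\<close>

text \<open>If no \<open>V\<close> worked, a bad pair could be chosen for every open neighbourhood
  of the origin. Ordered by reverse inclusion, these pairs form nets whose midpoints tend to the
  origin, while \<open>f c \<ge> 1\<close> prevents weak convergence of \<open>c\<close>.\<close>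

lemma weak_s_ext_normal:
  assumes s_ext: "0 \<in> weak_s_ext K"
  obtains V where "open V" "0 \<in> V"
    "\<And>c c'. c \<in> K \<Longrightarrow> c' \<in> K \<Longrightarrow> midpoint c c' \<in> V \<Longrightarrow> dual_apply f c < 1"
proof (rule ccontr)
  assume contr: "\<not> thesis"
  note witness = that
  define \<Delta> where "\<Delta> = {U :: 'a set. open U \<and> 0 \<in> U}"
  define q where "q = {(U, V). U \<in> \<Delta> \<and> V \<in> \<Delta> \<and> V \<subseteq> U}"
  have "\<exists>c c'. c \<in> K \<and> c' \<in> K \<and> midpoint c c' \<in> V \<and> \<not> dual_apply f c < 1"
    if "V \<in> \<Delta>" for V
  proof (rule ccontr)
    assume neg: "\<not> ?thesis"
    have thesis
      by (rule witness[of V]) (use that neg in \<open>auto simp: \<Delta>_def\<close>)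
    with contr show False ..
  qed
  then obtain c c' where c: "\<And>V. V \<in> \<Delta> \<Longrightarrow> c V \<in> K \<and> c' V \<in> K \<and> midpoint (c V) (c' V) \<in> V \<and>
      \<not> dual_apply f (c V) < 1"
    by metis
  have dir: "directed_set \<Delta> q"
    unfolding directed_set_def
  proof (intro conjI ballI)
    show "\<Delta> \<noteq> {}" by (auto simp: \<Delta>_def)
    show "preorder_on \<Delta> q"
      by (auto simp: preorder_on_def refl_on_def trans_def q_def)
    fix U V assume "U \<in> \<Delta>" "V \<in> \<Delta>"
    then show "\<exists>T\<in>\<Delta>. (U, T) \<in> q \<and> (V, T) \<in> q"
      by (intro bexI[of _ "U \<inter> V"]) (auto simp: \<Delta>_def q_def)
  qed
  have "limitin euclidean (\<lambda>V. midpoint (c V) (c' V)) 0 (tails \<Delta> q)"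
    unfolding limitin_def
  proof (intro conjI allI impI)
    fix U :: "'a set" assume U: "openin euclidean U \<and> 0 \<in> U"
    then show "eventually (\<lambda>V. midpoint (c V) (c' V) \<in> U) (tails \<Delta> q)"
      unfolding eventually_tails[OF dir] using c
      by (intro bexI[of _ U]) (auto simp: \<Delta>_def q_def)
  qed simp
  then have "limitin weak_topology c 0 (tails \<Delta> q)"
    using c by (intro weak_s_extD[OF s_ext dir]) auto
  moreover have "openin weak_topology (dual_apply f -` {..<1})"
    by (intro openin_weak_vimage) simp
  ultimately have "eventually (\<lambda>V. c V \<in> dual_apply f -` {..<1}) (tails \<Delta> q)"
    by (auto simp: limitin_def)
  then obtain U where "U \<in> \<Delta>" "\<And>V. V \<in> \<Delta> \<Longrightarrow> (U, V) \<in> q \<Longrightarrow> dual_apply f (c V) < 1"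
    unfolding eventually_tails[OF dir] by auto
  with c show False by (auto simp: q_def)
qed

text \<open>Every \<open>f\<close> is written as \<open>g - (g - f)\<close> with \<open>g\<close>
  and \<open>g - f\<close> in the dual cone, where \<open>g\<close> dominates both \<open>f\<close>
  and 0 on \<open>K\<close>. The span is thus the whole dual, not merely dense in it.\<close>

lemma weak_s_ext_imp_span_dual_cone:
  assumes K: "convex_cone K" and s_ext: "0 \<in> weak_s_ext K"
  shows "span (dual_cone K) = UNIV"
proof -
  have "f \<in> span (dual_cone K)" for f
  proof -
    obtain V where V: "open V" "0 \<in> V"
      "\<And>c c'. c \<in> K \<Longrightarrow> c' \<in> K \<Longrightarrow> midpoint c c' \<in> V \<Longrightarrow> dual_apply f c < 1"
      using weak_s_ext_normal[OF s_ext] by metis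
    define A where "A = {c \<in> K. dual_apply f c \<ge> 1}"
    \<comment> \<open>Averaging with all of \<open>K\<close> is what later forces \<open>g\<close>
      to be nonnegative on \<open>K\<close>: \<open>k\<close> can be scaled up while
      \<open>a\<close> stays fixed.\<close>
    define S where "S = {midpoint a k | a k. a \<in> A \<and> k \<in> K}"
    have "V \<inter> S = {}"
      using V(3) by (force simp: S_def A_def)
    then have "0 \<notin> closure S"
      using V(1,2) open_Int_closure_eq_empty[of V S] by blast
    moreover have "convex S"
    proof -
      have "convex A"
        using convex_Int[OF convex_coneD(2)[OF K] convex_dual_ge[of 1 f]]
        by (simp add: A_def Int_def)
      then have "convex ((\<lambda>x. (1/2) *\<^sub>R x) ` (\<Union>a\<in>A. \<Union>k\<in>K. {a + k}))"
        using convex_coneD(2)[OF K] by (intro convex_scaling convex_sums)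
      also have "(\<lambda>x. (1/2) *\<^sub>R x) ` (\<Union>a\<in>A. \<Union>k\<in>K. {a + k}) = S"
        by (auto simp: S_def midpoint_def image_iff)
      finally show ?thesis .
    qed
    ultimately obtain g where g: "\<And>a. a \<in> S \<Longrightarrow> dual_apply g a \<ge> 1"
      using separation_from_zero by blast
    have g2: "dual_apply g a + dual_apply g k \<ge> 2" if "a \<in> A" "k \<in> K" for a k
      using g[of "midpoint a k"] that by (auto simp: S_def midpoint_def)
    show ?thesis
    proof (cases "A = {}")
      \<comment> \<open>Here \<open>S\<close> is empty too and says nothing about \<open>g\<close>;
        but then \<open>f \<le> 0\<close> on \<open>K\<close>.\<close>
      case True
      have "- f \<in> dual_cone K"
        unfolding dual_cone_def
      proof (intro CollectI ballI, rule ccontr)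
        fix k assume k: "k \<in> K" "\<not> 0 \<le> dual_apply (- f) k"
        then have "inverse (dual_apply f k) *\<^sub>R k \<in> A"
          using convex_coneD(4)[OF K] by (simp add: A_def)
        with True show False by simp
      qed
      then have "- (- f) \<in> span (dual_cone K)" by (intro span_neg span_base)
      then show ?thesis by simp
    next
      case False
      then obtain a where a: "a \<in> A" by blast
      have g0: "dual_apply g k \<ge> 0" if k: "k \<in> K" for k
      proof (rule ccontr)
        assume neg: "\<not> dual_apply g k \<ge> 0"
        \<comment> \<open>With this \<open>t\<close> the sum of \<open>g\<close> at \<open>a\<close>
          and at \<open>t *\<^sub>R k\<close> is 0, contradicting the lower bound 2.\<close>
        define t where "t = dual_apply g a / (- dual_apply g k)"
        have "dual_apply g a \<ge> 2" using g2[OF a convex_coneD(1)[OF K]] by simp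
        with neg have "t \<ge> 0" by (simp add: t_def divide_nonneg_neg)
        from g2[OF a convex_coneD(4)[OF K this k]] neg show False by (simp add: t_def)
      qed
      \<comment> \<open>Where \<open>f k > 0\<close>, rescaling \<open>k\<close> to
        \<open>f\<close>-value 1 puts it into \<open>A\<close>, which gives even
        \<open>g k \<ge> 2 * f k\<close>.\<close>
      have gf: "dual_apply g k \<ge> dual_apply f k" if k: "k \<in> K" for k
      proof (cases "dual_apply f k > 0")
        case True
        then have "inverse (dual_apply f k) *\<^sub>R k \<in> A"
          using convex_coneD(4)[OF K] k by (simp add: A_def)
        from g2[OF this convex_coneD(1)[OF K]] True show ?thesis
          by (simp add: field_simps)
      qed (use g0[OF k] in simp)
      have "g \<in> dual_cone K" "g - f \<in> dual_cone K"
        using g0 gf by (auto simp: dual_cone_def)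
      then have "g - (g - f) \<in> span (dual_cone K)" by (intro span_diff span_base)
      then show ?thesis by simp
    qed
  qed
  then show ?thesis by blast
qed

text \<open>A functional lies in the bidual cone together with its negative exactly if it
  annihilates the dual cone. The strong dual is itself locally convex, so separation there shows
  that the annihilator is trivial exactly if the span is dense.\<close>

lemma pointed_bidual_cone_iff:
  "pointed (dual_cone (dual_cone K)) \<longleftrightarrow> closure (span (dual_cone K)) = UNIV"
proof
  assume dense: "closure (span (dual_cone K)) = UNIV"
  have "\<phi> = 0" if "\<phi> \<in> dual_cone (dual_cone K)" "- \<phi> \<in> dual_cone (dual_cone K)" for \<phi>
  proof -
    have "dual_cone K \<subseteq> {f. dual_apply \<phi> f = 0}"
      using that by (force simp: dual_cone_def)
    then have "span (dual_cone K) \<subseteq> {f. dual_apply \<phi> f = 0}"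
      by (rule span_minimal) (auto simp: subspace_def)
    moreover have "closed {f. dual_apply \<phi> f = 0}"
      by (intro closed_Collect_eq continuous_on_dual_apply continuous_intros)
    ultimately have "closure (span (dual_cone K)) \<subseteq> {f. dual_apply \<phi> f = 0}"
      by (rule closure_minimal)
    with dense show ?thesis by (intro dual_eqI) auto
  qed
  moreover have "0 \<in> dual_cone (dual_cone K)" by (simp add: dual_cone_def)
  moreover have "- \<phi> \<in> dual_cone (dual_cone K)" if "\<phi> \<in> uminus ` dual_cone (dual_cone K)" for \<phi>
    using that by force
  ultimately show "pointed (dual_cone (dual_cone K))"
    unfolding pointed_def using image_eqI[of 0 uminus 0 "dual_cone (dual_cone K)"] by fastforce
next
  assume pt: "pointed (dual_cone (dual_cone K))"
  have "f \<in> closure (span (dual_cone K))" for f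
  proof (rule ccontr)
    assume f: "f \<notin> closure (span (dual_cone K))"
    \<comment> \<open>Translating by \<open>f\<close> reduces the separation of \<open>f\<close>
      from the span to separation from the origin.\<close>
    define A where "A = (\<lambda>s. f - s) ` span (dual_cone K)"
    have "(\<lambda>s. f - s) -` closure (span (dual_cone K)) \<supseteq> A"
      using closure_subset[of "span (dual_cone K)"] by (auto simp: A_def)
    moreover have "closed ((\<lambda>s. f - s) -` closure (span (dual_cone K)))"
      by (intro closed_vimage continuous_intros) auto
    ultimately have "closure A \<subseteq> (\<lambda>s. f - s) -` closure (span (dual_cone K))"
      by (rule closure_minimal)
    with f have "0 \<notin> closure A" by auto
    moreover have "convex A"
    proof -
      have "A = (\<lambda>s. f + s) ` uminus ` span (dual_cone K)"
        by (auto simp: A_def image_image)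
      then show ?thesis
        by (metis convex_negations convex_translation subspace_imp_convex subspace_span)
    qed
    ultimately obtain \<phi> where \<phi>: "\<And>a. a \<in> A \<Longrightarrow> dual_apply \<phi> a \<ge> 1"
      using separation_from_zero by blast
    have le: "dual_apply \<phi> f - dual_apply \<phi> s \<ge> 1" if "s \<in> span (dual_cone K)" for s
      using \<phi>[of "f - s"] that by (simp add: A_def)
    have zero: "dual_apply \<phi> s = 0" if s: "s \<in> dual_cone K" for s
    proof (rule ccontr)
      assume ne: "dual_apply \<phi> s \<noteq> 0"
      \<comment> \<open>At this multiple of \<open>s\<close> the functional takes the value
        \<open>\<phi> f\<close>, so the bound \<open>le\<close> would read
        \<open>0 \<ge> 1\<close>.\<close>
      have "(dual_apply \<phi> f / dual_apply \<phi> s) *\<^sub>R s \<in> span (dual_cone K)"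
        using s by (intro span_scale span_base)
      from le[OF this] ne show False by simp
    qed
    have "\<phi> \<in> dual_cone (dual_cone K)" "- \<phi> \<in> dual_cone (dual_cone K)"
      using zero by (auto simp: dual_cone_def)
    then have "\<phi> \<in> dual_cone (dual_cone K) \<inter> uminus ` dual_cone (dual_cone K)"
      by (auto simp: image_iff intro!: bexI[of _ "- \<phi>"])
    then have "\<phi> = 0" using pt by (auto simp: pointed_def)
    with le[OF span_zero] show False by simp
  qed
  then show "closure (span (dual_cone K)) = UNIV" by blast
qed

section \<open>Equivalence of the six conditions\<close>

theorem theorem3p7:
  fixes K :: "'a::hausdorff_lcs set"
  assumes "convex_cone K" and "pointed K"
  shows "(weak_property_pi K \<longleftrightarrow> 0 \<in> bounded_pts_of_continuity K \<inter> denting_points K)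
    \<and> (weak_property_pi K \<longleftrightarrow> 0 \<in> bounded_pts_of_continuity K \<inter> weak_s_ext K)
    \<and> (weak_property_pi K \<longleftrightarrow>
         0 \<in> bounded_pts_of_continuity K \<and> pointed (dual_cone (dual_cone K)))
    \<and> (weak_property_pi K \<longleftrightarrow>
         0 \<in> bounded_pts_of_continuity K \<and> closure (span (dual_cone K)) = UNIV)
    \<and> (weak_property_pi K \<longleftrightarrow>
         (\<exists>n\<ge>1. \<exists>f :: nat \<Rightarrow> 'a dual. \<exists>l>0. (\<forall>i\<in>{1..n}. f i \<in> dual_cone K) \<and>
            vn_bounded ((\<Inter>i\<in>{1..n}. {x. dual_apply (f i) x < l}) \<inter> K)))"
proof -
  note K = assms(1)
  have bpc: "weak_property_pi K \<Longrightarrow> 0 \<in> bounded_pts_of_continuity K"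
    by (rule weak_property_pi_imp_bPC[OF K])
  have dp: "weak_property_pi K \<longleftrightarrow> 0 \<in> bounded_pts_of_continuity K \<inter> denting_points K"
    using bpc weak_property_pi_imp_denting[OF K] weak_property_piI_denting[OF K] by blast
  have dense: "closure (span (dual_cone K)) = UNIV" if "0 \<in> weak_s_ext K"
    using weak_s_ext_imp_span_dual_cone[OF K that] by simp
  \<comment> \<open>The way back from strong extremality passes through density of the span of the
    dual cone.\<close>
  have s_ext: "weak_property_pi K \<longleftrightarrow> 0 \<in> bounded_pts_of_continuity K \<inter> weak_s_ext K"
    using bpc weak_property_pi_imp_s_ext[OF K] weak_property_piI_dense_span[OF K] dense by blast
  \<comment> \<open>The weak property yields density by way of strong extremality.\<close>
  have span: "weak_property_pi K \<longleftrightarrow>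
      0 \<in> bounded_pts_of_continuity K \<and> closure (span (dual_cone K)) = UNIV"
    using s_ext dense weak_property_piI_dense_span[OF K] by blast
  have "weak_property_pi K \<longleftrightarrow>
      (\<exists>n\<ge>1. \<exists>f :: nat \<Rightarrow> 'a dual. \<exists>l>0. (\<forall>i\<in>{1..n}. f i \<in> dual_cone K) \<and>
         vn_bounded ((\<Inter>i\<in>{1..n}. {x. dual_apply (f i) x < l}) \<inter> K))" (is "_ \<longleftrightarrow> ?fin")
  proof
    assume "weak_property_pi K"
    then obtain f \<alpha> where "f \<in> dual_cone K" "\<alpha> > 0" "vn_bounded (K \<inter> {x. dual_apply f x < \<alpha>})"
      using weak_property_pi_slices[OF K] by metis
    then show ?fin
      by (intro exI[of _ 1] conjI exI[of _ "\<lambda>_. f"] exI[of _ \<alpha>]) (auto simp: Int_commute)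
  next
    assume ?fin
    then obtain n and f :: "nat \<Rightarrow> 'a dual" and l where f: "l > 0" "\<forall>i\<in>{1..n}. f i \<in> dual_cone K"
      "vn_bounded ((\<Inter>i\<in>{1..n}. {x. dual_apply (f i) x < l}) \<inter> K)"
      by blast
    show "weak_property_pi K"
    proof (rule weak_property_piI_finite)
      show "finite (f ` {1..n})" "f ` {1..n} \<subseteq> dual_cone K" "l > 0" using f by auto
      show "vn_bounded (K \<inter> {x. \<forall>g\<in>f ` {1..n}. dual_apply g x < l})"
        by (rule vn_bounded_subset[OF f(3)]) auto
    qed
  qed
  \<comment> \<open>The condition on the bidual cone is exchanged for density of the span.\<close>
  with dp s_ext span pointed_bidual_cone_iff[of K] show ?thesis by blast
qed

end
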